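(* A dyadic compact Hausdorff space is metrizable if and only if it is hereditarily supercompact.
   Context: A compact space $X$ is dyadic if $X$ is a continuous image of the Cantor cube $\{0,1\}^\kappa$ for some cardinal $\kappa$. A topological space $X$ is supercompact if it has a subbase $\mathcal B$ of its topology such that each cover of $X$ by elements of $\mathcal B$ has a subcover consisting of at most two elements. A space is hereditarily supercompact if each of its closed subspaces is supercompact. *)

theory Defs
  imports "HOL-Analysis.Analysis"
begin

definition cantor_cube :: "'i set \<Rightarrow> ('i \<Rightarrow> bool) topology" where
  "cantor_cube I = product_topology (\<lambda>_. discrete_topology UNIV) I"

(* HOL has no existential quantifier over types, so the cardinal kappa is represented by a set I
   over an explicit index type.  When "dyadic_space TYPE('i) X" is a hypothesis of a theorem, 'i is
   universally quantified, so the hypothesis covers Cantor cubes of every weight. *)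
definition dyadic_space :: "'i itself \<Rightarrow> 'a topology \<Rightarrow> bool" where
  "dyadic_space (_ :: 'i itself) X \<longleftrightarrow>
     compact_space X \<and>
     (\<exists>(I :: 'i set) f. continuous_map (cantor_cube I) X f \<and>
        f ` topspace (cantor_cube I) = topspace X)"

(* The open sets are the unions of finite intersections of members of B, where the empty
   intersection counts as the whole space. *)
definition subbase_of :: "'a topology \<Rightarrow> 'a set set \<Rightarrow> bool" where
  "subbase_of X B \<longleftrightarrow>
     (\<forall>U\<in>B. openin X U) \<and>
     openin X = arbitrary union_of (finite intersection_of (\<lambda>U. U \<in> B) relative_to topspace X)"

definition supercompact_space :: "'a topology \<Rightarrow> bool" where
  "supercompact_space X \<longleftrightarrow>
     (\<exists>B. subbase_of X B \<and>
        (\<forall>C. C \<subseteq> B \<and> \<Union>C = topspace X \<longrightarrow>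
           (\<exists>D. D \<subseteq> C \<and> finite D \<and> card D \<le> 2 \<and> \<Union>D = topspace X)))"

definition hereditarily_supercompact_space :: "'a topology \<Rightarrow> bool" where
  "hereditarily_supercompact_space X \<longleftrightarrow>
     (\<forall>S. closedin X S \<longrightarrow> supercompact_space (subtopology X S))"

end

theory Submission
  imports Defs
begin

text \<open>
  Dually, a compact space is supercompact iff it has a closed subbase that is binary: every linked
  (pairwise intersecting) subfamily has a common point.

  For a compact metric space, such a subbase is built in stages. Given a finite binary family of
  closed sets, cut the space into small closed cells with disjoint nonempty open cores, add the
  cells to the family and replace every old set by the union of the cells it meets. For every
  maximal clique of the intersection graph that contains a cell, choose a private point in the core
  of that cell and add it to all members of the clique. This creates no new intersections, and
  it gives a common point to every linked subfamily containing a cell. The old sets only grow, by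
  rapidly decreasing amounts, so the closures of the increasing unions still form a binary family.

  Conversely, let \<open>f\<close> map a Cantor cube onto a nonmetrizable space \<open>X\<close>. Then \<open>f\<close> depends on
  uncountably many coordinates, and a \<open>\<Delta>\<close>-system of finite supports yields a subcube \<open>2\<^sup>E\<close>, \<open>E\<close>
  uncountable, on which \<open>f\<close> separates points. Regard \<open>E\<close> as a set of branches of the binary tree; the
  closure of the images of the cones \<open>{r \<in> E. t < r}\<close>, \<open>t\<close> a node, is not supercompact. Indeed
  let \<open>C r\<close> be the clopen set of those points whose \<open>r\<close>-th coordinate is true. A binary subbase provides for each
  \<open>r\<close> a basic closed set \<open>H r\<close> with \<open>{r} \<in> H r \<subseteq> C r\<close> that contains the cone of some node, and
  uncountably many \<open>H r\<close> share that node. If \<open>r\<close> is an accumulation point of this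
  uncountable set and \<open>s\<close>, \<open>t\<close> branch off \<open>r\<close> at different levels, then \<open>C s \<inter> C t \<subseteq> C r\<close>, while
  two such \<open>{s}\<close>, \<open>{t}\<close> lie in a common basic closed set \<open>F\<close> disjoint from \<open>C r\<close>. So \<open>F\<close>, \<open>H s\<close>,
  \<open>H t\<close> are linked without a common point.
\<close>

section \<open>Binary closed subbases of compact metrizable spaces\<close>

text \<open>Once the members of \<open>B\<close> are open, so are their finite intersections, and
  generating the topology becomes a local condition at each point.\<close>

lemma subbase_of_iff:
  "subbase_of X B \<longleftrightarrow>
     (\<forall>U\<in>B. openin X U) \<and>
     (\<forall>U x. openin X U \<and> x \<in> U \<longrightarrow>
        (\<exists>D. finite D \<and> D \<subseteq> B \<and> x \<in> topspace X \<inter> \<Inter>D \<and> topspace X \<inter> \<Inter>D \<subseteq> U))"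
proof -
  let ?P = "finite intersection_of (\<lambda>U. U \<in> B) relative_to topspace X"
  have P: "?P V \<longleftrightarrow> (\<exists>D. finite D \<and> D \<subseteq> B \<and> V = topspace X \<inter> \<Inter>D)" for V
    by (auto simp: relative_to_def intersection_of_def)
  have op: "openin X V" if V: "?P V" "\<forall>U\<in>B. openin X U" for V
  proof -
    obtain D where D: "finite D" "D \<subseteq> B" "V = topspace X \<inter> \<Inter>D"
      using iffD1[OF P V(1)] by blast
    have "openin X (\<Inter>(insert (topspace X) D))"
      using D V by (intro openin_Inter) auto
    with D show ?thesis by simp
  qed
  have ex: "(\<exists>V. ?P V \<and> x \<in> V \<and> V \<subseteq> U) \<longleftrightarrow>
    (\<exists>D. finite D \<and> D \<subseteq> B \<and> x \<in> topspace X \<inter> \<Inter>D \<and> topspace X \<inter> \<Inter>D \<subseteq> U)" for U x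
    unfolding P by blast
  show ?thesis
    unfolding subbase_of_def openin_topology_base_unique ex using op by blast
qed

section \<open>Common points for finite linked families\<close>

lemma finite_embed_infinite:
  assumes "finite A" "infinite B"
  shows "\<exists>f. inj_on f A \<and> f ` A \<subseteq> B"
proof -
  obtain T where T: "finite T" "card T = card A" "T \<subseteq> B"
    using infinite_arbitrarily_large[OF assms(2)] by blast
  then obtain f where "bij_betw f A T"
    using assms(1) finite_same_card_bij by metis
  with T show ?thesis
    by (metis bij_betw_def)
qed

text \<open>
  \<open>G j\<close> for \<open>j \<in> J\<close> are the cells, with cores \<open>W j\<close>. Infinite cores allow distinct cliques to choose
  distinct points; a one-point cell lies in exactly one maximal clique, so there the choice is harmless.
\<close>

lemma binary_extension:
  fixes G W :: "'i \<Rightarrow> 'a set"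
  assumes I: "finite I" "J \<subseteq> I"
    and W: "\<And>j. j \<in> J \<Longrightarrow> W j \<subseteq> G j" "\<And>j. j \<in> J \<Longrightarrow> W j \<noteq> {}"
      "\<And>j. j \<in> J \<Longrightarrow> infinite (W j) \<or> (\<exists>x. G j = {x})"
    and disj: "disjoint_family_on W J"
    and absorb: "\<And>i j. \<lbrakk>i \<in> I; j \<in> J; G i \<inter> W j \<noteq> {}\<rbrakk> \<Longrightarrow> G j \<subseteq> G i"
  obtains F where "\<And>i. i \<in> I \<Longrightarrow> G i \<subseteq> F i" "\<And>i. i \<in> I \<Longrightarrow> finite (F i - G i)"
    "\<And>i j. \<lbrakk>i \<in> I; j \<in> I; F i \<inter> F j \<noteq> {}\<rbrakk> \<Longrightarrow> G i \<inter> G j \<noteq> {}"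
    "\<And>i x. \<lbrakk>i \<in> I; x \<in> F i - G i\<rbrakk> \<Longrightarrow> \<exists>j\<in>J. x \<in> G j \<and> G i \<inter> G j \<noteq> {}"
    "\<And>L. \<lbrakk>L \<subseteq> I; L \<inter> J \<noteq> {}; \<forall>i\<in>L. \<forall>j\<in>L. G i \<inter> G j \<noteq> {}\<rbrakk> \<Longrightarrow> \<Inter>(F ` L) \<noteq> {}"
proof -
  define linked where "linked L \<longleftrightarrow> (\<forall>i\<in>L. \<forall>j\<in>L. G i \<inter> G j \<noteq> {})" for L
  \<comment> \<open>The maximal cliques of the intersection graph that contain a cell.\<close>
  define MC where "MC = {c. c \<subseteq> I \<and> c \<inter> J \<noteq> {} \<and> linked c \<and> (\<forall>c'. c \<subseteq> c' \<and> c' \<subseteq> I \<and> linked c' \<longrightarrow> c' = c)}"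
  \<comment> \<open>Each set of indices receives a point of the core \<open>W j\<close>, and
    distinct sets receive distinct points when the core is infinite.\<close>
  have "\<exists>h. h ` Pow I \<subseteq> W j \<and> (infinite (W j) \<longrightarrow> inj_on h (Pow I))" if j: "j \<in> J" for j
  proof (cases "infinite (W j)")
    case True
    then show ?thesis using finite_embed_infinite[of "Pow I" "W j"] I(1) by auto
  next
    case False
    obtain x where "x \<in> W j" using W(2)[OF j] by blast
    with False show ?thesis by (intro exI[of _ "\<lambda>_. x"]) auto
  qed
  then obtain h where h: "\<And>j. j \<in> J \<Longrightarrow> h j ` Pow I \<subseteq> W j" "\<And>j. \<lbrakk>j \<in> J; infinite (W j)\<rbrakk> \<Longrightarrow> inj_on (h j) (Pow I)"
    by metis
  have "\<forall>c\<in>MC. \<exists>v. v \<in> c \<and> v \<in> J"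
    unfolding MC_def by blast
  then obtain v where v: "\<And>c. c \<in> MC \<Longrightarrow> v c \<in> c \<and> v c \<in> J"
    by metis
  define p where "p c = h (v c) c" for c
  define F where "F i = G i \<union> p ` {c \<in> MC. i \<in> c}" for i
  have MC: "c \<subseteq> I" "linked c" "\<And>c'. \<lbrakk>c \<subseteq> c'; c' \<subseteq> I; linked c'\<rbrakk> \<Longrightarrow> c' = c" if "c \<in> MC" for c
    using that unfolding MC_def by auto
  have finMC: "finite MC"
    using I(1) by (intro finite_subset[of MC "Pow I"]) (auto simp: MC_def)
  have pW: "p c \<in> W (v c)" if "c \<in> MC" for c
    using h(1)[of "v c"] v[OF that] MC(1)[OF that] unfolding p_def by auto
  \<comment> \<open>By \<open>absorb\<close>, \<open>G i\<close> contains the whole cell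
    \<open>G (v c)\<close>. Every member of \<open>c\<close> meets that cell, so adding
    \<open>i\<close> keeps \<open>c\<close> linked, and maximality puts \<open>i\<close> in
    \<open>c\<close>.\<close>
  have key: "i \<in> c" if c: "c \<in> MC" and i: "i \<in> I" "p c \<in> G i" for i c
  proof -
    have sub: "G (v c) \<subseteq> G i"
      using absorb[OF i(1), of "v c"] v[OF c] pW[OF c] i(2) by blast
    have meets: "G i \<inter> G u \<noteq> {}" if "u \<in> c" for u
      using MC(2)[OF c] v[OF c] that sub unfolding linked_def by blast
    have "linked (insert i c)"
      using MC(2)[OF c] meets i(2) unfolding linked_def by (auto simp: Int_commute)
    then have "insert i c = c"
      using MC(1,3)[OF c] i(1) by (metis insert_subset subset_insertI)
    then show ?thesis by blast
  qed
  have pt: "i \<in> c" if c: "c \<in> MC" and i: "i \<in> I" "p c \<in> F i" for i c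
  proof (cases "p c \<in> G i")
    case True
    then show ?thesis using key[OF c i(1)] by simp
  next
    case notG: False
    then obtain c' where c': "c' \<in> MC" "i \<in> c'" "p c = p c'"
      using i(2) unfolding F_def by blast
    show ?thesis
    proof (cases "c = c'")
      case ne: False
      \<comment> \<open>Distinct cliques share a private point only in a common finite core, hence
        in a one-point cell. As \<open>G i\<close> meets that cell, it contains \<open>p c\<close>
        after all.\<close>
      have "v c = v c'"
        using disj v[OF c] v[OF c'(1)] pW[OF c] pW[OF c'(1)] c'(3) unfolding disjoint_family_on_def by auto
      then have "\<not> inj_on (h (v c)) (Pow I)"
        using c'(3) ne MC(1)[OF c] MC(1)[OF c'(1)] unfolding p_def inj_on_def by auto
      then obtain x where x: "G (v c) = {x}"
        using h(2) W(3) v[OF c] by blast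
      have "p c = x" using x pW[OF c] W(1) v[OF c] by blast
      moreover have "G i \<inter> G (v c) \<noteq> {}"
        using MC(2)[OF c'(1)] c'(2) v[OF c'(1)] \<open>v c = v c'\<close> unfolding linked_def by auto
      ultimately show ?thesis using x notG by auto
    next
      case True
      then show ?thesis using c'(2) by simp
    qed
  qed
  show ?thesis
  proof (rule that[of F])
    show "G i \<subseteq> F i" for i unfolding F_def by blast
    show "finite (F i - G i)" for i
      using finMC by (intro finite_subset[of "F i - G i" "p ` MC"]) (auto simp: F_def)
    show "G i \<inter> G j \<noteq> {}" if ij: "i \<in> I" "j \<in> I" "F i \<inter> F j \<noteq> {}" for i j
    proof -
      obtain x where x: "x \<in> F i" "x \<in> F j" using ij(3) by blast
      show ?thesis
      proof (cases "\<exists>c\<in>MC. x = p c")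
        case True
        then obtain c where "c \<in> MC" "x = p c" by blast
        then have "i \<in> c" "j \<in> c" using pt ij x by auto
        then show ?thesis using MC(2)[OF \<open>c \<in> MC\<close>] unfolding linked_def by blast
      next
        case False
        with x have "x \<in> G i" "x \<in> G j" unfolding F_def by auto
        then show ?thesis by blast
      qed
    qed
    show "\<exists>j\<in>J. x \<in> G j \<and> G i \<inter> G j \<noteq> {}" if x: "i \<in> I" "x \<in> F i - G i" for i x
    proof -
      obtain c where c: "c \<in> MC" "i \<in> c" "x = p c"
        using x(2) unfolding F_def by blast
      have "x \<in> G (v c)" using pW[OF c(1)] v[OF c(1)] W(1) c(3) by blast
      moreover have "G i \<inter> G (v c) \<noteq> {}"
        using MC(2)[OF c(1)] v[OF c(1)] c(2) unfolding linked_def by blast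
      ultimately show ?thesis using v[OF c(1)] by blast
    qed
    show "\<Inter>(F ` L) \<noteq> {}" if L: "L \<subseteq> I" "L \<inter> J \<noteq> {}" "\<forall>i\<in>L. \<forall>j\<in>L. G i \<inter> G j \<noteq> {}" for L
    proof -
      \<comment> \<open>Extend \<open>L\<close> to a maximal clique; it still contains a cell, and
        its private point was added to every member of \<open>L\<close>.\<close>
      have "finite {c. c \<subseteq> I \<and> linked c}" "L \<in> {c. c \<subseteq> I \<and> linked c}"
        using I(1) L unfolding linked_def by auto
      then obtain c where c: "c \<subseteq> I" "linked c" "L \<subseteq> c" "\<forall>c'\<in>{c. c \<subseteq> I \<and> linked c}. c \<subseteq> c' \<longrightarrow> c = c'"
        using finite_has_maximal2[of "{c. c \<subseteq> I \<and> linked c}" L] by blast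
      then have "c \<in> MC" using L(2) unfolding MC_def by blast
      then have "p c \<in> F i" if "i \<in> L" for i
        using that c(3) unfolding F_def by blast
      then show ?thesis by blast
    qed
  qed
qed

section \<open>Fine closed cells with disjoint open cores\<close>

text \<open>From each further open set the closure of the union obtained so far is removed. The part
  lost lies in that closure, so the closures still cover.\<close>

lemma disjoint_open_refinement:
  assumes "finite \<U>" "\<And>U. U \<in> \<U> \<Longrightarrow> openin X U"
  shows "\<exists>\<W>. finite \<W> \<and> disjoint \<W> \<and> (\<forall>W\<in>\<W>. openin X W \<and> (\<exists>U\<in>\<U>. W \<subseteq> U)) \<and>
     \<Union>\<U> \<subseteq> X closure_of \<Union>\<W>"
  using assms
proof (induction \<U> rule: finite_induct)
  case empty
  show ?case by (intro exI[of _ "{}"]) auto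
next
  case (insert U \<U>)
  then obtain \<W> where \<W>: "finite \<W>" "disjoint \<W>" "\<And>W. W \<in> \<W> \<Longrightarrow> openin X W \<and> (\<exists>U\<in>\<U>. W \<subseteq> U)"
     "\<Union>\<U> \<subseteq> X closure_of \<Union>\<W>"
    by auto
  define V where "V = U - X closure_of \<Union>\<W>"
  have opV: "openin X V"
    unfolding V_def using insert.prems by (intro openin_diff) auto
  have sub: "W \<subseteq> X closure_of \<Union>\<W>" if "W \<in> \<W>" for W
  proof -
    have "\<Union>\<W> \<subseteq> X closure_of \<Union>\<W>"
      using \<W>(3) openin_subset by (intro closure_of_subset) fast
    with that show ?thesis by blast
  qed
  have "disjoint (insert V \<W>)"
    using \<W>(2) sub unfolding V_def pairwise_insert disjnt_def by blast
  moreover have "U \<subseteq> X closure_of \<Union>(insert V \<W>)"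
  proof
    fix x assume x: "x \<in> U"
    show "x \<in> X closure_of \<Union>(insert V \<W>)"
    proof (cases "x \<in> V")
      case True
      then have "x \<in> X closure_of V"
        using closure_of_subset[OF openin_subset[OF opV]] by blast
      then show ?thesis by (simp add: closure_of_Un)
    next
      case False
      with x show ?thesis unfolding V_def by (simp add: closure_of_Un)
    qed
  qed
  moreover have "\<Union>\<U> \<subseteq> X closure_of \<Union>(insert V \<W>)"
    using \<W>(4) by (auto simp: closure_of_Un)
  ultimately show ?case
    using \<W> opV by (intro exI[of _ "insert V \<W>"]) (auto simp: V_def)
qed

context Metric_space
begin

text \<open>A finite cover by balls of radius \<open>e/2\<close> is made disjoint. Finite members
  are then split into isolated points, which gives the dichotomy required for the choice of private
  points.\<close>

lemma fine_disjoint_opens: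
  assumes "compact_space mtopology" "e > 0"
  obtains \<W> where "finite \<W>" "disjoint \<W>"
    "\<And>W. W \<in> \<W> \<Longrightarrow> openin mtopology W \<and> W \<noteq> {} \<and> (infinite W \<or> (\<exists>x. W = {x}))"
    "\<And>W x y. \<lbrakk>W \<in> \<W>; x \<in> mtopology closure_of W; y \<in> mtopology closure_of W\<rbrakk> \<Longrightarrow> d x y \<le> e"
    "(\<Union>W\<in>\<W>. mtopology closure_of W) = M"
proof -
  have "mtotally_bounded M"
    using assms(1) compact_space_eq_mcomplete_mtotally_bounded by blast
  then obtain T where T: "finite T" "T \<subseteq> M" "M \<subseteq> (\<Union>x\<in>T. mball x (e/2))"
    unfolding mtotally_bounded_def using assms(2) half_gt_zero by metis
  have "\<exists>\<W>. finite \<W> \<and> disjoint \<W> \<and> (\<forall>W\<in>\<W>. openin mtopology W \<and> (\<exists>U\<in>(\<lambda>x. mball x (e/2)) ` T. W \<subseteq> U)) \<and>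
     \<Union>((\<lambda>x. mball x (e/2)) ` T) \<subseteq> mtopology closure_of \<Union>\<W>"
    using T(1) by (intro disjoint_open_refinement) auto
  then obtain \<V> where \<V>: "finite \<V>" "disjoint \<V>" "\<And>W. W \<in> \<V> \<Longrightarrow> openin mtopology W"
     "\<And>W. W \<in> \<V> \<Longrightarrow> \<exists>x\<in>T. W \<subseteq> mball x (e/2)" "M \<subseteq> mtopology closure_of \<Union>\<V>"
    using T(3) by (auto 4 3)
  define \<W> where "\<W> = {W\<in>\<V>. infinite W} \<union> (\<lambda>x. {x}) ` \<Union>{W\<in>\<V>. finite W}"
  have cases: "\<exists>V\<in>\<V>. infinite V \<and> W = V \<or> finite V \<and> (\<exists>x\<in>V. W = {x})" if "W \<in> \<W>" for W
    using that unfolding \<W>_def by blast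
  then have sub: "\<exists>V\<in>\<V>. W \<subseteq> V" if "W \<in> \<W>" for W
    using that by fast
  show ?thesis
  proof
    have "finite (\<Union>{W\<in>\<V>. finite W})"
      using \<V>(1) by (intro finite_Union) auto
    then show fin: "finite \<W>" using \<V>(1) unfolding \<W>_def by simp
    show "disjoint \<W>"
    proof (rule pairwiseI)
      fix W W' assume W: "W \<in> \<W>" "W' \<in> \<W>" "W \<noteq> W'"
      obtain V where V: "V \<in> \<V>" "infinite V \<and> W = V \<or> finite V \<and> (\<exists>x\<in>V. W = {x})"
        using cases[OF W(1)] by blast
      obtain V' where V': "V' \<in> \<V>" "infinite V' \<and> W' = V' \<or> finite V' \<and> (\<exists>x\<in>V'. W' = {x})"
        using cases[OF W(2)] by blast
      show "disjnt W W'"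
      proof (cases "V = V'")
        case True
        then show ?thesis using V(2) V'(2) W(3) by auto
      next
        case False
        then have "disjnt V V'" using \<V>(2) V(1) V'(1) unfolding pairwise_def by blast
        moreover have "W \<subseteq> V" "W' \<subseteq> V'" using V(2) V'(2) by auto
        ultimately show ?thesis by (meson disjnt_subset1 disjnt_subset2)
      qed
    qed
    show "openin mtopology W \<and> W \<noteq> {} \<and> (infinite W \<or> (\<exists>x. W = {x}))" if W: "W \<in> \<W>" for W
    proof (cases "infinite W")
      case True
      then show ?thesis using cases[OF W] \<V>(3) by auto
    next
      case False
      then obtain V x where V: "V \<in> \<V>" "finite V" "x \<in> V" "W = {x}"
        using cases[OF W] by blast
      have "V \<subseteq> M" using openin_subset[OF \<V>(3)[OF V(1)]] by simp
      then have "closedin mtopology (V - {x})"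
        using V(2) Hausdorff_space_mtopology by (intro closedin_Hausdorff_finite) auto
      then have "openin mtopology (V - (V - {x}))"
        using \<V>(3)[OF V(1)] by (rule openin_diff[rotated])
      moreover have "V - (V - {x}) = W" using V by blast
      ultimately show ?thesis using V(4) by auto
    qed
    show "d x y \<le> e" if W: "W \<in> \<W>" and xy: "x \<in> mtopology closure_of W" "y \<in> mtopology closure_of W" for W x y
    proof -
      obtain t where t: "W \<subseteq> mball t (e/2)"
        using sub[OF W] \<V>(4) by blast
      then have "mtopology closure_of W \<subseteq> mcball t (e/2)"
        by (intro closure_of_minimal) auto
      with xy have "t \<in> M" "x \<in> M" "y \<in> M" "d t x \<le> e/2" "d t y \<le> e/2" by auto
      then show ?thesis using triangle[of x t y] commute[of t x] by simp
    qed
    have "\<Union>\<V> = \<Union>\<W>" unfolding \<W>_def by blast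
    then have "mtopology closure_of \<Union>\<V> = (\<Union>W\<in>\<W>. mtopology closure_of W)"
      using fin by (simp add: closure_of_Union)
    then show "(\<Union>W\<in>\<W>. mtopology closure_of W) = M"
      using \<V>(5) closure_of_subset_topspace[of mtopology "\<Union>\<V>"] by auto
  qed
qed

end

section \<open>One stage of refinement\<close>

text \<open>Indexed, so that an index keeps naming the same set while this set grows from stage to
  stage.\<close>

definition binary_on :: "'i set \<Rightarrow> ('i \<Rightarrow> 'a set) \<Rightarrow> bool" where
  "binary_on I F \<longleftrightarrow> (\<forall>L\<subseteq>I. L \<noteq> {} \<and> (\<forall>i\<in>L. \<forall>j\<in>L. F i \<inter> F j \<noteq> {}) \<longrightarrow> \<Inter>(F ` L) \<noteq> {})"

context Metric_space
begin

text \<open>Indices below \<open>k\<close> carry the old sets, the others the new cells. Replacing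
  old sets by cells of diameter at most \<open>e/3\<close> moves them by at most \<open>e/3\<close>,
  too little to bridge a gap above \<open>e\<close>. The private points lie in cells meeting the
  enlarged sets and cost at most another \<open>e/3\<close>.\<close>

lemma refine_binary_family:
  assumes cpt: "compact_space mtopology" and e: "e > 0"
    and cl: "\<And>i. i < k \<Longrightarrow> closedin mtopology (F i)"
    and gap: "\<And>i j x y. \<lbrakk>i < k; j < k; F i \<inter> F j = {}; x \<in> F i; y \<in> F j\<rbrakk> \<Longrightarrow> d x y > e"
    and bin: "binary_on {..<k} F"
  obtains k' F' where "k \<le> (k' :: nat)" "\<And>i. i < k' \<Longrightarrow> closedin mtopology (F' i)" "binary_on {..<k'} F'"
    "\<And>i. i < k \<Longrightarrow> F i \<subseteq> F' i"
    "\<And>i x. \<lbrakk>i < k; x \<in> F' i\<rbrakk> \<Longrightarrow> \<exists>y\<in>F i. d x y \<le> e"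
    "M \<subseteq> (\<Union>i\<in>{k..<k'}. F' i)"
    "\<And>i x y. \<lbrakk>k \<le> i; i < k'; x \<in> F' i; y \<in> F' i\<rbrakk> \<Longrightarrow> d x y \<le> e"
proof -
  obtain \<W> where \<W>: "finite \<W>" "disjoint \<W>"
    "\<And>W. W \<in> \<W> \<Longrightarrow> openin mtopology W \<and> W \<noteq> {} \<and> (infinite W \<or> (\<exists>x. W = {x}))"
    and small: "\<And>W x y. \<lbrakk>W \<in> \<W>; x \<in> mtopology closure_of W; y \<in> mtopology closure_of W\<rbrakk> \<Longrightarrow> d x y \<le> e/3"
    and cover: "(\<Union>W\<in>\<W>. mtopology closure_of W) = M"
    using fine_disjoint_opens[OF cpt, of "e/3"] e by (metis divide_pos_pos zero_less_numeral)
  define k' where "k' = k + card \<W>"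
  obtain w0 where w0: "bij_betw w0 {0..<card \<W>} \<W>"
    using ex_bij_betw_nat_finite[OF \<W>(1)] by blast
  define w where "w i = w0 (i - k)" for i
  have w: "bij_betw w {k..<k'} \<W>"
  proof -
    have "bij_betw (\<lambda>i. i - k) {k..<k'} {0..<card \<W>}"
      by (rule bij_betwI[where g = "\<lambda>i. i + k"]) (auto simp: k'_def)
    from bij_betw_trans[OF this w0] show ?thesis
      by (simp add: w_def[abs_def] comp_def)
  qed
  let ?cl = "\<lambda>W. mtopology closure_of W"
  have w_in: "w j \<in> \<W>" if "j \<in> {k..<k'}" for j
    using w that unfolding bij_betw_def by blast
  have sub_cl: "W \<subseteq> ?cl W" "W \<subseteq> M" if "W \<in> \<W>" for W
    using \<W>(3)[OF that] openin_subset[of mtopology W] closure_of_subset[of W mtopology] by auto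
  \<comment> \<open>An open core misses the closure of every other core, so it meets no closed cell
    but its own. This yields the absorption hypothesis of \<open>binary_extension\<close>.\<close>
  have cell_unique: "W = W'" if W: "W \<in> \<W>" "W' \<in> \<W>" and x: "x \<in> ?cl W" "x \<in> W'" for W W' x
  proof (rule ccontr)
    assume "W \<noteq> W'"
    then have "W' \<inter> W = {}" using \<W>(2) W unfolding pairwise_def disjnt_def by blast
    then have "W' \<inter> ?cl W = {}"
      using openin_Int_closure_of_eq_empty \<W>(3)[OF W(2)] by metis
    with x show False by blast
  qed
  define G where "G i = (if i < k then \<Union>(?cl ` {W\<in>\<W>. ?cl W \<inter> F i \<noteq> {}}) else ?cl (w i))" for i
  have Gclosed: "closedin mtopology (G i)" for i
    unfolding G_def using \<W>(1) by (auto intro!: closedin_Union)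
  have FM: "F i \<subseteq> M" if "i < k" for i
    using closedin_subset[OF cl[OF that]] by simp
  have FG: "F i \<subseteq> G i" if i: "i < k" for i
  proof
    fix x assume x: "x \<in> F i"
    then obtain W where "W \<in> \<W>" "x \<in> ?cl W"
      using FM[OF i] cover by blast
    with x show "x \<in> G i" using i unfolding G_def by auto
  qed
  have G_old: "\<exists>y\<in>F i. d x y \<le> e/3" if i: "i < k" "x \<in> G i" for i x
  proof -
    obtain W y where "W \<in> \<W>" "x \<in> ?cl W" "y \<in> ?cl W" "y \<in> F i"
      using i unfolding G_def by auto
    then show ?thesis using small by blast
  qed
  have G_new: "d x y \<le> e/3" if "i \<in> {k..<k'}" "x \<in> G i" "y \<in> G i" for i x y
    using small[OF w_in[OF that(1)]] that unfolding G_def by auto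
  have GM: "G i \<subseteq> M" for i
    using closedin_subset[OF Gclosed[of i]] by simp
  obtain F' where F': "\<And>i. i \<in> {..<k'} \<Longrightarrow> G i \<subseteq> F' i" "\<And>i. i \<in> {..<k'} \<Longrightarrow> finite (F' i - G i)"
    "\<And>i j. \<lbrakk>i \<in> {..<k'}; j \<in> {..<k'}; F' i \<inter> F' j \<noteq> {}\<rbrakk> \<Longrightarrow> G i \<inter> G j \<noteq> {}"
    "\<And>i x. \<lbrakk>i \<in> {..<k'}; x \<in> F' i - G i\<rbrakk> \<Longrightarrow> \<exists>j\<in>{k..<k'}. x \<in> G j \<and> G i \<inter> G j \<noteq> {}"
    "\<And>L. \<lbrakk>L \<subseteq> {..<k'}; L \<inter> {k..<k'} \<noteq> {}; \<forall>i\<in>L. \<forall>j\<in>L. G i \<inter> G j \<noteq> {}\<rbrakk> \<Longrightarrow> \<Inter>(F' ` L) \<noteq> {}"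
  proof (rule binary_extension[of "{..<k'}" "{k..<k'}" w G])
    show "w j \<subseteq> G j" "w j \<noteq> {}" if "j \<in> {k..<k'}" for j
      using sub_cl(1)[OF w_in[OF that]] \<W>(3)[OF w_in[OF that]] that unfolding G_def by auto
    show "infinite (w j) \<or> (\<exists>x. G j = {x})" if j: "j \<in> {k..<k'}" for j
    proof -
      have "?cl (w j) = w j" if "w j = {x}" for x
      proof -
        have "x \<in> M" using sub_cl(2)[OF w_in[OF j]] that by auto
        then have "closedin mtopology {x}"
          using Hausdorff_space_mtopology by (intro closedin_Hausdorff_finite) auto
        then show ?thesis unfolding that by (simp add: closure_of_eq)
      qed
      then show ?thesis using \<W>(3)[OF w_in[OF j]] j unfolding G_def by auto
    qed
    show "disjoint_family_on w {k..<k'}"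
      unfolding disjoint_family_on_def
    proof (intro ballI impI)
      fix m n assume mn: "m \<in> {k..<k'}" "n \<in> {k..<k'}" "m \<noteq> n"
      then have "w m \<noteq> w n"
        using w unfolding bij_betw_def inj_on_def by blast
      then show "w m \<inter> w n = {}"
        using \<W>(2) w_in mn unfolding pairwise_def disjnt_def by blast
    qed
    show "G j \<subseteq> G i" if ij: "i \<in> {..<k'}" "j \<in> {k..<k'}" "G i \<inter> w j \<noteq> {}" for i j
    proof (cases "i < k")
      case True
      then obtain W x where W: "W \<in> \<W>" "x \<in> ?cl W" "x \<in> w j" "?cl W \<inter> F i \<noteq> {}"
        using ij(3) unfolding G_def by auto
      then have "W = w j" using cell_unique w_in ij(2) by blast
      then show ?thesis using W True ij(2) unfolding G_def by auto
    next
      case False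
      then have i: "i \<in> {k..<k'}" using ij by auto
      obtain x where "x \<in> ?cl (w i)" "x \<in> w j"
        using ij(3) False unfolding G_def by auto
      then have "w i = w j" using cell_unique w_in[OF i] w_in[OF ij(2)] by blast
      then show ?thesis using False ij(2) unfolding G_def by auto
    qed
  qed (auto simp: k'_def)
  have GG: "F i \<inter> F j \<noteq> {}" if ij: "i < k" "j < k" "G i \<inter> G j \<noteq> {}" for i j
  proof
    assume dis: "F i \<inter> F j = {}"
    obtain x where x: "x \<in> G i" "x \<in> G j" using ij(3) by blast
    obtain y z where yz: "y \<in> F i" "d x y \<le> e/3" "z \<in> F j" "d x z \<le> e/3"
      using G_old[OF ij(1) x(1)] G_old[OF ij(2) x(2)] by blast
    have "d y z \<le> d x y + d x z"
      using triangle''[of y x z] FM[OF ij(1)] FM[OF ij(2)] GM x(1) yz by blast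
    with gap[OF ij(1,2) dis yz(1,3)] yz e show False by linarith
  qed
  show ?thesis
  proof (rule that[of k' F'])
    show "k \<le> k'" by (simp add: k'_def)
    show "closedin mtopology (F' i)" if i: "i < k'" for i
    proof -
      have "F' i - G i \<subseteq> M"
        using F'(4)[of i] i GM by blast
      then have "closedin mtopology (F' i - G i)"
        using F'(2)[of i] i Hausdorff_space_mtopology by (intro closedin_Hausdorff_finite) auto
      then have "closedin mtopology (G i \<union> (F' i - G i))"
        using Gclosed by blast
      moreover have "G i \<union> (F' i - G i) = F' i" using F'(1)[of i] i by blast
      ultimately show ?thesis by simp
    qed
    show "F i \<subseteq> F' i" if "i < k" for i
      using FG[OF that] F'(1)[of i] that by (auto simp: k'_def)
    show "binary_on {..<k'} F'"
      unfolding binary_on_def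
    proof (intro allI impI, elim conjE)
      fix L assume L: "L \<subseteq> {..<k'}" "L \<noteq> {}" "\<forall>i\<in>L. \<forall>j\<in>L. F' i \<inter> F' j \<noteq> {}"
      have linked: "\<forall>i\<in>L. \<forall>j\<in>L. G i \<inter> G j \<noteq> {}"
        using L(1,3) F'(3) by blast
      show "\<Inter>(F' ` L) \<noteq> {}"
      proof (cases "L \<inter> {k..<k'} = {}")
        case True
        then have Lk: "L \<subseteq> {..<k}" using L(1) by force
        then have "\<forall>i\<in>L. \<forall>j\<in>L. F i \<inter> F j \<noteq> {}"
          using linked GG by blast
        then have "\<Inter>(F ` L) \<noteq> {}"
          using bin L(2) Lk unfolding binary_on_def by blast
        moreover have "F i \<subseteq> F' i" if "i \<in> L" for i
          using FG[of i] F'(1)[of i] that Lk L(1) by blast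
        ultimately show ?thesis by blast
      next
        case False
        show ?thesis by (rule F'(5)[OF L(1) False linked])
      qed
    qed
    show "\<exists>y\<in>F i. d x y \<le> e" if ix: "i < k" "x \<in> F' i" for i x
    proof -
      have "i \<in> {..<k'}" using ix(1) by (auto simp: k'_def)
      show ?thesis
      proof (cases "x \<in> G i")
        case True
        then obtain y where "y \<in> F i" "d x y \<le> e/3"
          using G_old[OF ix(1)] by blast
        then show ?thesis using e by (intro bexI[of _ y]) auto
      next
        case False
        then obtain j z where j: "j \<in> {k..<k'}" "x \<in> G j" "z \<in> G i" "z \<in> G j"
          using F'(4)[of i x] ix(2) \<open>i \<in> {..<k'}\<close> by blast
        obtain y where y: "y \<in> F i" "d z y \<le> e/3"
          using G_old[OF ix(1) j(3)] by blast
        have "d x y \<le> d x z + d z y"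
          using triangle[of x z y] FM[OF ix(1)] GM j y by blast
        moreover have "d x z \<le> e/3" using G_new j by blast
        ultimately show ?thesis using y e by (intro bexI[of _ y]) auto
      qed
    qed
    show "M \<subseteq> (\<Union>i\<in>{k..<k'}. F' i)"
    proof
      fix x assume "x \<in> M"
      then obtain W where W: "W \<in> \<W>" "x \<in> ?cl W" using cover by blast
      then obtain i where i: "i \<in> {k..<k'}" "W = w i"
        using w unfolding bij_betw_def by blast
      then have "x \<in> G i" using W unfolding G_def by auto
      then show "x \<in> (\<Union>i\<in>{k..<k'}. F' i)" using F'(1)[of i] i(1) by force
    qed
    show "d x y \<le> e" if i: "k \<le> i" "i < k'" and xy: "x \<in> F' i" "y \<in> F' i" for i x y
    proof -
      \<comment> \<open>A private point added to a cell lies in another cell that meets it; two such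
        detours and the cell itself add up to \<open>3 * (e/3)\<close>.\<close>
      have *: "\<exists>z\<in>G i. d u z \<le> e/3 \<and> u \<in> M" if u: "u \<in> F' i" for u
      proof (cases "u \<in> G i")
        case True
        moreover from this have "u \<in> M" using GM by blast
        ultimately show ?thesis using e by (intro bexI[of _ u]) auto
      next
        case False
        then obtain j z where j: "j \<in> {k..<k'}" "u \<in> G j" "z \<in> G i" "z \<in> G j"
          using F'(4)[of i u] i u False by (metis (no_types) DiffI Int_emptyI lessThan_iff)
        then show ?thesis using G_new[OF j(1,2,4)] GM by blast
      qed
      obtain a b where ab: "a \<in> G i" "d x a \<le> e/3" "b \<in> G i" "d y b \<le> e/3" "x \<in> M" "y \<in> M"
        using *[OF xy(1)] *[OF xy(2)] by blast
      have "d x y \<le> d x a + d a y" "d a y \<le> d a b + d b y"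
        using triangle[of x a y] triangle[of a b y] ab GM by blast+
      moreover have "d a b \<le> e/3" using G_new[of i a b] i ab by auto
      ultimately show ?thesis using ab commute[of b y] by linarith
    qed
  qed
qed

text \<open>Half a Lebesgue number for the cover of \<open>F i\<close> by the complement of
  \<open>F j\<close> is a strict lower bound for one disjoint pair; there are finitely many
  pairs.\<close>

lemma disjoint_closed_gap:
  assumes cpt: "compact_space mtopology" and cl: "\<And>i. i < (k::nat) \<Longrightarrow> closedin mtopology (F i)"
  shows "\<exists>e>0. \<forall>i<k. \<forall>j<k. F i \<inter> F j = {} \<longrightarrow> (\<forall>x\<in>F i. \<forall>y\<in>F j. e < d x y)"
proof -
  have "\<exists>e>0. \<forall>x\<in>F i. \<forall>y\<in>F j. e < d x y" if ij: "i < k" "j < k" "F i \<inter> F j = {}" for i j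
  proof -
    have Fi: "compactin mtopology (F i)" using closedin_compact_space[OF cpt cl[OF ij(1)]] .
    have sub: "F i \<subseteq> M" "F j \<subseteq> M"
      using closedin_subset[OF cl[OF ij(1)]] closedin_subset[OF cl[OF ij(2)]] by auto
    have "\<exists>\<epsilon>>0. \<forall>x\<in>F i. \<exists>U\<in>{M - F j}. mball x \<epsilon> \<subseteq> U"
    proof (rule lebesgue_number[OF Fi])
      show "F i \<subseteq> \<Union>{M - F j}" using sub ij by blast
      show "openin mtopology U" if "U \<in> {M - F j}" for U
        using that cl[OF ij(2)] by (auto simp: closedin_def)
    qed
    then obtain \<epsilon> where \<epsilon>: "\<epsilon> > 0" "\<And>x. x \<in> F i \<Longrightarrow> mball x \<epsilon> \<subseteq> M - F j" by blast
    have "\<epsilon>/2 < d x y" if "x \<in> F i" "y \<in> F j" for x y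
    proof (rule ccontr)
      assume "\<not> \<epsilon>/2 < d x y"
      then have "y \<in> mball x \<epsilon>" using that sub \<epsilon>(1) by auto
      then show False using \<epsilon>(2) that by blast
    qed
    then show ?thesis using \<epsilon>(1) half_gt_zero by blast
  qed
  then obtain f where f: "\<And>i j. \<lbrakk>i < k; j < k; F i \<inter> F j = {}\<rbrakk> \<Longrightarrow> f i j > (0::real) \<and> (\<forall>x\<in>F i. \<forall>y\<in>F j. f i j < d x y)"
    by metis
  define P where "P = {(i,j). i < k \<and> j < k \<and> F i \<inter> F j = {}}"
  have "finite P"
    by (rule finite_subset[of _ "{..<k} \<times> {..<k}"]) (auto simp: P_def)
  \<comment> \<open>The extra \<open>1\<close> keeps the minimum defined when no two of the sets are
    disjoint.\<close>
  then have fin: "finite (insert 1 ((\<lambda>(i,j). f i j) ` P))" by simp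
  define e where "e = Min (insert 1 ((\<lambda>(i,j). f i j) ` P))"
  have "e > 0"
    unfolding e_def using fin f by (subst Min_gr_iff) (auto simp: P_def)
  moreover have "e \<le> f i j" if "i < k" "j < k" "F i \<inter> F j = {}" for i j
    unfolding e_def using that by (intro Min_le[OF fin]) (auto simp: P_def)
  ultimately show ?thesis using f by (meson order_le_less_trans)
qed

end

section \<open>Infinitely many stages and their limit\<close>

context Metric_space
begin

text \<open>Dependent choice iterates the refinement, starting with no sets at all. Scales at least
  halve, so that later growth sums geometrically. The factor \<open>7\<close> exceeds the
  \<open>3 + 3\<close> by which two limit sets can approach each other.\<close>

lemma binary_closed_families:
  assumes cpt: "compact_space mtopology"
  obtains k :: "nat \<Rightarrow> nat" and F :: "nat \<Rightarrow> nat \<Rightarrow> 'a set" and e :: "nat \<Rightarrow> real"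
  where "\<And>n i. i < k n \<Longrightarrow> closedin mtopology (F n i)" "\<And>n. binary_on {..<k n} (F n)"
    "\<And>n. e n > 0" "\<And>n. e (Suc n) \<le> e n / 2" "\<And>n. e n \<le> (1/2)^n"
    "\<And>n i j x y. \<lbrakk>i < k n; j < k n; F n i \<inter> F n j = {}; x \<in> F n i; y \<in> F n j\<rbrakk> \<Longrightarrow> 7 * e n < d x y"
    "\<And>n. k n \<le> k (Suc n)" "\<And>n i. i < k n \<Longrightarrow> F n i \<subseteq> F (Suc n) i"
    "\<And>n i x. \<lbrakk>i < k n; x \<in> F (Suc n) i\<rbrakk> \<Longrightarrow> \<exists>y\<in>F n i. d x y \<le> e n"
    "\<And>n. M \<subseteq> (\<Union>i\<in>{k n..<k (Suc n)}. F (Suc n) i)"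
    "\<And>n i x y. \<lbrakk>k n \<le> i; i < k (Suc n); x \<in> F (Suc n) i; y \<in> F (Suc n) i\<rbrakk> \<Longrightarrow> d x y \<le> e n"
proof -
  define P where "P n s = (case s of (k, F, e) \<Rightarrow>
      (\<forall>i<k. closedin mtopology (F i)) \<and> binary_on {..<k} F \<and> 0 < e \<and> e \<le> (1/2)^n \<and>
      (\<forall>i<k. \<forall>j<k. F i \<inter> F j = {} \<longrightarrow> (\<forall>x\<in>F i. \<forall>y\<in>F j. 7 * e < d x y)))"
    for n :: nat and s :: "nat \<times> (nat \<Rightarrow> 'a set) \<times> real"
  define R where "R s s' = (case (s, s') of ((k, F, e), (k', F', e')) \<Rightarrow>
      e' \<le> e / 2 \<and> k \<le> k' \<and> (\<forall>i<k. F i \<subseteq> F' i \<and> (\<forall>x\<in>F' i. \<exists>y\<in>F i. d x y \<le> e)) \<and>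
      M \<subseteq> (\<Union>i\<in>{k..<k'}. F' i) \<and> (\<forall>i\<in>{k..<k'}. \<forall>x\<in>F' i. \<forall>y\<in>F' i. d x y \<le> e))"
    for s s' :: "nat \<times> (nat \<Rightarrow> 'a set) \<times> real"
  have "\<exists>f. \<forall>n. P n (f n) \<and> R (f n) (f (Suc n))"
  proof (rule dependent_nat_choice[of P "\<lambda>_. R"])
    show "\<exists>s. P 0 s"
      by (rule exI[of _ "(0, \<lambda>_. {}, 1)"]) (auto simp: P_def binary_on_def)
    show "\<exists>s'. P (Suc n) s' \<and> R s s'" if s: "P n s" for n s
    proof -
      obtain k F e where seq: "s = (k, F, e)" using prod_cases3 by blast
      have *: "\<And>i. i < k \<Longrightarrow> closedin mtopology (F i)" "binary_on {..<k} F" "0 < e" "e \<le> (1/2)^n"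
        "\<And>i j x y. \<lbrakk>i < k; j < k; F i \<inter> F j = {}; x \<in> F i; y \<in> F j\<rbrakk> \<Longrightarrow> 7 * e < d x y"
        using s unfolding P_def seq by auto
      have gap: "e < d x y" if "i < k" "j < k" "F i \<inter> F j = {}" "x \<in> F i" "y \<in> F j" for i j x y
        using *(5)[OF that] *(3) by linarith
      show ?thesis
      proof (rule refine_binary_family[OF cpt *(3,1) gap *(2)])
        fix k' F'
        assume F': "k \<le> (k' :: nat)" "\<And>i. i < k' \<Longrightarrow> closedin mtopology (F' i)" "binary_on {..<k'} F'"
          "\<And>i. i < k \<Longrightarrow> F i \<subseteq> F' i"
          "\<And>i x. \<lbrakk>i < k; x \<in> F' i\<rbrakk> \<Longrightarrow> \<exists>y\<in>F i. d x y \<le> e"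
          "M \<subseteq> (\<Union>i\<in>{k..<k'}. F' i)"
          "\<And>i x y. \<lbrakk>k \<le> i; i < k'; x \<in> F' i; y \<in> F' i\<rbrakk> \<Longrightarrow> d x y \<le> e"
        have "\<exists>g>0. \<forall>i<k'. \<forall>j<k'. F' i \<inter> F' j = {} \<longrightarrow> (\<forall>x\<in>F' i. \<forall>y\<in>F' j. g < d x y)"
          by (rule disjoint_closed_gap[OF cpt F'(2)])
        then obtain g where g: "g > 0" "\<forall>i<k'. \<forall>j<k'. F' i \<inter> F' j = {} \<longrightarrow> (\<forall>x\<in>F' i. \<forall>y\<in>F' j. g < d x y)"
          by metis
        \<comment> \<open>Here \<open>e/2\<close> bounds the total later growth, and
          \<open>g/7\<close> converts the gap of the new family into the margin demanded by
          \<open>P\<close>.\<close>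
        define e' where "e' = min (e/2) (g/7)"
        have e': "0 < e'" "e' \<le> e/2" "7 * e' \<le> g"
          using *(3) g(1) unfolding e'_def by auto
        have "P (Suc n) (k', F', e')"
          unfolding P_def using F'(2,3) e' *(4) g(2) by fastforce
        moreover have "R s (k', F', e')"
          unfolding R_def seq using e'(2) F'(1,4,5,6,7) by auto
        ultimately show "\<exists>s'. P (Suc n) s' \<and> R s s'" by blast
      qed
    qed
  qed
  then obtain f where f: "\<And>n. P n (f n)" "\<And>n. R (f n) (f (Suc n))" by blast
  define k where "k n = fst (f n)" for n
  define F where "F n = fst (snd (f n))" for n
  define e where "e n = snd (snd (f n))" for n
  have fn: "f n = (k n, F n, e n)" for n
    unfolding k_def F_def e_def by simp
  show ?thesis
    using f unfolding fn P_def R_def by (intro that[of k F e]) auto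
qed

text \<open>The limits \<open>C i\<close> form the binary closed subbase. A finite linked family of
  limits is linked already at a common stage, where binarity gives a common point.\<close>

theorem compact_supercompact_space:
  assumes cpt: "compact_space mtopology"
  shows "supercompact_space mtopology"
proof (rule binary_closed_families[OF cpt])
  fix k :: "nat \<Rightarrow> nat" and F :: "nat \<Rightarrow> nat \<Rightarrow> 'a set" and e :: "nat \<Rightarrow> real"
  assume F: "\<And>n i. i < k n \<Longrightarrow> closedin mtopology (F n i)" "\<And>n. binary_on {..<k n} (F n)"
    and e: "\<And>n. e n > 0" "\<And>n. e (Suc n) \<le> e n / 2" "\<And>n. e n \<le> (1/2)^n"
    and gap: "\<And>n i j x y. \<lbrakk>i < k n; j < k n; F n i \<inter> F n j = {}; x \<in> F n i; y \<in> F n j\<rbrakk> \<Longrightarrow> 7 * e n < d x y"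
    and k_Suc: "\<And>n. k n \<le> k (Suc n)" and F_Suc: "\<And>n i. i < k n \<Longrightarrow> F n i \<subseteq> F (Suc n) i"
    and near_Suc: "\<And>n i x. \<lbrakk>i < k n; x \<in> F (Suc n) i\<rbrakk> \<Longrightarrow> \<exists>y\<in>F n i. d x y \<le> e n"
    and cover: "\<And>n. M \<subseteq> (\<Union>i\<in>{k n..<k (Suc n)}. F (Suc n) i)"
    and mesh: "\<And>n i x y. \<lbrakk>k n \<le> i; i < k (Suc n); x \<in> F (Suc n) i; y \<in> F (Suc n) i\<rbrakk> \<Longrightarrow> d x y \<le> e n"
  have FM: "F n i \<subseteq> M" if "i < k n" for n i
    using closedin_subset[OF F(1)[OF that]] by simp
  have kmono: "k n \<le> k m" if "n \<le> m" for n m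
    using lift_Suc_mono_le[of k] k_Suc that by blast
  have Fmono: "F n i \<subseteq> F m i" if "n \<le> m" "i < k n" for n m i
    using that(1)
  proof (induction rule: dec_induct)
    case (step l)
    then show ?case using F_Suc[of i l] kmono[of n l] that(2) by auto
  qed simp
  \<comment> \<open>The subtracted term makes the induction telescope: \<open>2 * e (Suc l)\<close>
    is at most \<open>e l\<close>.\<close>
  have near: "\<exists>y\<in>F n i. d x y \<le> 2 * e n - 2 * e m" if "n \<le> m" "i < k n" "x \<in> F m i" for n m i x
    using that(1,3)
  proof (induction arbitrary: x rule: dec_induct)
    case base
    then show ?case using FM[OF that(2)] by (intro bexI[of _ x]) auto
  next
    case (step l)
    have il: "i < k l" "i < k (Suc l)" using kmono[of n l] kmono[of n "Suc l"] step(1) that(2) by auto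
    obtain z where z: "z \<in> F l i" "d x z \<le> e l"
      using near_Suc[OF il(1) step.prems] by blast
    obtain y where y: "y \<in> F n i" "d z y \<le> 2 * e n - 2 * e l"
      using step.IH[OF z(1)] by blast
    have "d x y \<le> d x z + d z y"
      using triangle FM[OF il(2)] FM[OF il(1)] FM[OF that(2)] step.prems z y by blast
    then show ?case using y z e(2)[of l] by (intro bexI[of _ y]) auto
  qed
  define C where "C i = mtopology closure_of (\<Union>{F n i |n. i < k n})" for i
  define A where "A = {i. \<exists>n. i < k n}"
  have Ccl: "closedin mtopology (C i)" for i unfolding C_def by simp
  have FC: "F n i \<subseteq> C i" if "i < k n" for n i
  proof -
    have "\<Union>{F n i |n. i < k n} \<subseteq> C i"
      unfolding C_def using FM by (intro closure_of_subset) auto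
    then show ?thesis using that by blast
  qed
  \<comment> \<open>Passing to the closure costs one more \<open>e n\<close> beyond the growth
    \<open>2 * e n\<close>.\<close>
  have CF: "\<exists>y\<in>F n i. d x y \<le> 3 * e n" if ix: "i < k n" "x \<in> C i" for n i x
  proof -
    have "x \<in> M \<and> (\<forall>r>0. \<exists>z\<in>\<Union>{F n i |n. i < k n}. z \<in> mball x r)"
      using ix(2) unfolding C_def metric_closure_of by simp
    then obtain z m where z: "z \<in> F m i" "i < k m" "d x z < e n" "x \<in> M" "z \<in> M"
      using e(1)[of n] by fastforce
    have "\<exists>y\<in>F n i. d z y \<le> 2 * e n"
    proof (cases "n \<le> m")
      case True
      then obtain y where "y \<in> F n i" "d z y \<le> 2 * e n - 2 * e m"
        using near[OF True ix(1) z(1)] by blast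
      then show ?thesis using e(1)[of m] by (intro bexI[of _ y]) auto
    next
      case False
      then have "z \<in> F n i" using Fmono[of m n i] z by auto
      then show ?thesis using e(1)[of n] z by (intro bexI[of _ z]) auto
    qed
    then obtain y where y: "y \<in> F n i" "d z y \<le> 2 * e n" by blast
    then have "d x y \<le> d x z + d z y"
      using triangle z FM[OF ix(1)] by blast
    then show ?thesis using y z by (intro bexI[of _ y]) auto
  qed
  \<comment> \<open>A common point of the limits would bring the stage-\<open>n\<close> sets within
    \<open>6 * e n\<close>, below the gap \<open>7 * e n\<close>.\<close>
  have CC: "F n i \<inter> F n j \<noteq> {}" if ij: "i < k n" "j < k n" "C i \<inter> C j \<noteq> {}" for n i j
  proof
    assume dis: "F n i \<inter> F n j = {}"
    obtain x where x: "x \<in> C i" "x \<in> C j" using ij(3) by blast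
    obtain y z where yz: "y \<in> F n i" "d x y \<le> 3 * e n" "z \<in> F n j" "d x z \<le> 3 * e n"
      using CF[OF ij(1) x(1)] CF[OF ij(2) x(2)] by blast
    have "x \<in> M" using x closedin_subset[OF Ccl] by auto
    then have "d y z \<le> d x y + d x z"
      using triangle'' FM ij yz by blast
    with gap[OF ij(1,2) dis yz(1,3)] yz e(1)[of n] show False by linarith
  qed
  have inter_fin: "\<Inter>(C ` L) \<noteq> {}" if L: "finite L" "L \<subseteq> A" "L \<noteq> {}" "\<forall>i\<in>L. \<forall>j\<in>L. C i \<inter> C j \<noteq> {}" for L
  proof -
    have "\<forall>i\<in>L. \<exists>n. i < k n"
      using L(2) unfolding A_def by blast
    then obtain nn where nn: "\<And>i. i \<in> L \<Longrightarrow> i < k (nn i)"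
      by metis
    define n where "n = Max (nn ` L)"
    have lt: "i < k n" if "i \<in> L" for i
      using nn[OF that] kmono[of "nn i" n] L(1) that unfolding n_def by (simp add: order_less_le_trans)
    then have "\<Inter>(F n ` L) \<noteq> {}"
      using F(2)[of n] CC L(3,4) unfolding binary_on_def by (metis lessThan_iff subsetI)
    then show ?thesis using FC lt by blast
  qed
  define B where "B = (\<lambda>i. M - C i) ` A"
  have "subbase_of mtopology B"
    unfolding subbase_of_iff
  proof (intro conjI allI impI ballI)
    show "openin mtopology U" if "U \<in> B" for U
      using that Ccl openin_closedin_eq unfolding B_def by fastforce
    fix U x assume "openin mtopology U \<and> x \<in> U"
    then obtain r where r: "r > 0" "mball x r \<subseteq> U" and xM: "x \<in> M"
      unfolding openin_mtopology by blast
    obtain n where n: "(1/2)^n < r/7"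
      using real_arch_pow_inv[of "r/7" "1/2"] r by auto
    then have en: "7 * e n < r" using e(3)[of n] by linarith
    \<comment> \<open>Remove every cell of one fine stage whose limit misses \<open>x\<close>. Each
      remaining point lies in a cell whose limit contains \<open>x\<close>, hence within
      \<open>3 * e (Suc n) + e n\<close> of \<open>x\<close>.\<close>
    let ?J = "{i\<in>{k n..<k (Suc n)}. x \<notin> C i}"
    let ?D = "(\<lambda>i. M - C i) ` ?J"
    have "M \<inter> \<Inter>?D \<subseteq> mball x r"
    proof
      fix y assume y: "y \<in> M \<inter> \<Inter>?D"
      then obtain i where i: "i \<in> {k n..<k (Suc n)}" "y \<in> F (Suc n) i"
        using cover[of n] by blast
      then have "y \<in> C i" using FC by auto
      then have xC: "x \<in> C i" using y i by blast
      obtain z where z: "z \<in> F (Suc n) i" "d x z \<le> 3 * e (Suc n)"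
        using CF[OF _ xC, of "Suc n"] i by auto
      have "d z y \<le> e n" using mesh[of n i z y] i z by auto
      moreover have "d x y \<le> d x z + d z y" using triangle[of x z y] xM y z FM[of i "Suc n"] i by auto
      ultimately have "d x y < r" using z en e(2)[of n] e(1)[of n] by linarith
      then show "y \<in> mball x r" using xM y by simp
    qed
    moreover have "?D \<subseteq> B" unfolding B_def A_def by auto
    ultimately show "\<exists>D. finite D \<and> D \<subseteq> B \<and> x \<in> topspace mtopology \<inter> \<Inter>D \<and> topspace mtopology \<inter> \<Inter>D \<subseteq> U"
      using xM r(2) by (intro exI[of _ ?D]) auto
  qed
  moreover have "\<exists>D. D \<subseteq> S \<and> finite D \<and> card D \<le> 2 \<and> \<Union>D = M" if S: "S \<subseteq> B" "\<Union>S = M" for S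
  proof -
    obtain L where L: "L \<subseteq> A" "S = (\<lambda>i. M - C i) ` L"
      using S(1) unfolding B_def by (meson subset_imageE)
    have opS: "\<forall>U\<in>S. openin mtopology U"
      using L(2) Ccl openin_closedin_eq by fastforce
    have "compactin mtopology M"
      using cpt unfolding compact_space_def by simp
    then have "\<exists>S'. finite S' \<and> S' \<subseteq> S \<and> M \<subseteq> \<Union>S'"
      by (rule compactinD) (use opS S(2) in auto)
    then obtain S' where S': "finite S'" "S' \<subseteq> S" "M \<subseteq> \<Union>S'"
      by metis
    then obtain L' where L': "finite L'" "L' \<subseteq> L" "S' = (\<lambda>i. M - C i) ` L'"
      using L(2) by (meson finite_subset_image)
    show ?thesis
    proof (cases "L' = {}")
      case True
      then have "M = {}" using S' L' by auto
      then show ?thesis by (intro exI[of _ "{}"]) auto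
    next
      case False
      \<comment> \<open>The closed complements of a finite subcover have no common point, so two of
        them are disjoint; the corresponding two open sets cover.\<close>
      have "\<Inter>(C ` L') = {}"
      proof (rule equals0I)
        fix x assume x: "x \<in> \<Inter>(C ` L')"
        then have "x \<in> M" using False closedin_subset[OF Ccl] by auto
        then show False using S'(3) x unfolding L'(3) by auto
      qed
      then obtain i j where ij: "i \<in> L'" "j \<in> L'" "C i \<inter> C j = {}"
        using inter_fin[of L'] L'(1,2) L(1) False by blast
      have "\<Union>{M - C i, M - C j} = M" using ij(3) by blast
      moreover have "{M - C i, M - C j} \<subseteq> S" using ij L L'(2) by blast
      ultimately show ?thesis
        by (intro exI[of _ "{M - C i, M - C j}"]) (auto simp: card_insert_if)
    qed
  qed
  ultimately show ?thesis
    unfolding supercompact_space_def by auto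
qed

end

lemma compact_metrizable_imp_supercompact:
  assumes "compact_space X" "metrizable_space X"
  shows "supercompact_space X"
proof -
  obtain M d where "Metric_space M d" "X = Metric_space.mtopology M d"
    using assms(2) unfolding metrizable_space_def by blast
  then show ?thesis
    using Metric_space.compact_supercompact_space assms(1) by blast
qed

lemma compact_metrizable_imp_hereditarily_supercompact:
  assumes "compact_space X" "metrizable_space X"
  shows "hereditarily_supercompact_space X"
  unfolding hereditarily_supercompact_space_def
  using assms compact_metrizable_imp_supercompact metrizable_space_subtopology
    closedin_compact_space compact_space_subtopology by blast

section \<open>A tree obstruction to supercompactness\<close>

text \<open>The sets \<open>topspace X - \<Union>{b \<in> D. y \<notin> b}\<close> play the role of the basic closed sets \<open>H r\<close> and \<open>F\<close>.\<close>

lemma clopen_blocks: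
  assumes "compact_space X" "subbase_of X B" "openin X C" "closedin X C"
  obtains D where "finite D" "D \<subseteq> B"
    "\<And>y. y \<in> C \<Longrightarrow> topspace X - \<Union>{b \<in> D. y \<notin> b} \<subseteq> C"
proof -
  let ?K = "topspace X - C"
  have K: "openin X ?K" "compactin X ?K"
    using assms by (auto intro!: closedin_compact_space)
  have "\<exists>D. finite D \<and> D \<subseteq> B \<and> x \<in> topspace X \<inter> \<Inter>D \<and> topspace X \<inter> \<Inter>D \<subseteq> ?K" if "x \<in> ?K" for x
    using assms(2) K that unfolding subbase_of_iff by blast
  then obtain F where F: "\<And>x. x \<in> ?K \<Longrightarrow> finite (F x) \<and> F x \<subseteq> B \<and> x \<in> topspace X \<inter> \<Inter>(F x) \<and>
       topspace X \<inter> \<Inter>(F x) \<subseteq> ?K"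
    by metis
  have op: "openin X (topspace X \<inter> \<Inter>(F x))" if "x \<in> ?K" for x
  proof -
    have "openin X (\<Inter>(insert (topspace X) (F x)))"
      using F[OF that] assms(2) unfolding subbase_of_iff by (intro openin_Inter) auto
    then show ?thesis by simp
  qed
  have "?K \<subseteq> \<Union>((\<lambda>x. topspace X \<inter> \<Inter>(F x)) ` ?K)"
    using F by blast
  then obtain \<F> where \<F>: "finite \<F>" "\<F> \<subseteq> (\<lambda>x. topspace X \<inter> \<Inter>(F x)) ` ?K" "?K \<subseteq> \<Union>\<F>"
    using compactinD[OF K(2), of "(\<lambda>x. topspace X \<inter> \<Inter>(F x)) ` ?K"] op by blast
  then obtain S where S: "S \<subseteq> ?K" "finite S" "\<F> = (\<lambda>x. topspace X \<inter> \<Inter>(F x)) ` S"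
    by (meson finite_subset_image)
  have cover: "?K \<subseteq> (\<Union>x\<in>S. topspace X \<inter> \<Inter>(F x))"
    using \<F>(3) unfolding S(3) .
  show ?thesis
  proof
    show "finite (\<Union>x\<in>S. F x)"
      using S(1,2) F by (intro finite_UN_I) blast+
    show "(\<Union>x\<in>S. F x) \<subseteq> B"
      using S(1) F by blast
    fix y assume y: "y \<in> C"
    show "topspace X - \<Union>{b \<in> (\<Union>x\<in>S. F x). y \<notin> b} \<subseteq> C"
    proof
      fix z assume z: "z \<in> topspace X - \<Union>{b \<in> (\<Union>x\<in>S. F x). y \<notin> b}"
      show "z \<in> C"
      proof (rule ccontr)
        assume "z \<notin> C"
        with z have "z \<in> ?K" by blast
        then have "z \<in> (\<Union>x\<in>S. topspace X \<inter> \<Inter>(F x))"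
          by (rule subsetD[OF cover])
        then obtain x where x: "x \<in> S" "z \<in> \<Inter>(F x)"
          by auto
        have "y \<in> topspace X" using y assms(3) openin_subset by blast
        \<comment> \<open>The block around \<open>x\<close> lies outside \<open>C\<close>, so one of
          its finitely many subbasic sets misses \<open>y\<close>, while \<open>z\<close> lies in
          all of them.\<close>
        then obtain b where "b \<in> F x" "y \<notin> b"
          using F[of x] x S y by blast
        with z x show False by blast
      qed
    qed
  qed
qed

text \<open>Binarity for the three basic closed sets complementary to \<open>\<Union>P\<close>,
  \<open>\<Union>Q\<close> and \<open>\<Union>R\<close>: a subcover with two members uses at most
  two of the families, so these two would already cover.\<close>

lemma supercompact_linked_triple:
  assumes cov: "\<And>C. \<lbrakk>C \<subseteq> B; \<Union>C = Y\<rbrakk> \<Longrightarrow> \<exists>D. D \<subseteq> C \<and> finite D \<and> card D \<le> 2 \<and> \<Union>D = Y"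
    and B: "P \<subseteq> B" "Q \<subseteq> B" "R \<subseteq> B" "\<Union>B \<subseteq> Y"
    and linked: "\<not> Y \<subseteq> \<Union>(P \<union> Q)" "\<not> Y \<subseteq> \<Union>(P \<union> R)" "\<not> Y \<subseteq> \<Union>(Q \<union> R)"
  shows "\<not> Y \<subseteq> \<Union>(P \<union> Q \<union> R)"
proof
  assume "Y \<subseteq> \<Union>(P \<union> Q \<union> R)"
  then have "\<Union>(P \<union> Q \<union> R) = Y" using B by blast
  moreover have "P \<union> Q \<union> R \<subseteq> B" using B by blast
  ultimately obtain D where D: "D \<subseteq> P \<union> Q \<union> R" "finite D" "card D \<le> 2" "\<Union>D = Y"
    using cov by metis
  have "card D = 0 \<or> card D = 1 \<or> card D = 2"
    using D by linarith
  then obtain u v where uv: "D \<subseteq> {u, v}"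
    using D(2) by (auto simp: card_1_singleton_iff card_2_iff)
  have "D \<subseteq> P \<union> Q \<or> D \<subseteq> P \<union> R \<or> D \<subseteq> Q \<union> R"
    using uv D(1) by blast
  then show False
    using linked D(4) Union_mono by metis
qed

section \<open>Branches of the binary tree\<close>

text \<open>If an initial segment isolated each branch, then sending branches to these segments
  would inject \<open>L\<close> into the countable set of finite words.\<close>

lemma uncountable_branches_accumulate:
  fixes L :: "(nat \<Rightarrow> bool) set"
  assumes "uncountable L"
  obtains r where "r \<in> L" "\<And>n. \<exists>s\<in>L. s \<noteq> r \<and> (\<forall>i<n. s i = r i)"
proof (rule ccontr)
  assume "\<not> thesis"
  then have "\<forall>r\<in>L. \<exists>n. \<forall>s\<in>L. (\<forall>i<n. s i = r i) \<longrightarrow> s = r"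
    using that by metis
  then obtain n where n: "\<And>r s. \<lbrakk>r \<in> L; s \<in> L; \<forall>i<n r. s i = r i\<rbrakk> \<Longrightarrow> s = r"
    by metis
  have "inj_on (\<lambda>r. map r [0..<n r]) L"
  proof (rule inj_onI)
    fix r s assume rs: "r \<in> L" "s \<in> L" "map r [0..<n r] = map s [0..<n s]"
    then have "n r = n s" by (metis diff_zero length_map length_upt)
    with rs(3) have "\<forall>i<n r. s i = r i" by simp
    with n rs show "r = s" by blast
  qed
  then have "countable L"
    by (rule countable_image_inj_on[OF countableI_type])
  with assms show False by simp
qed

text \<open>Abstract form of the obstruction: \<open>a r\<close> stands for \<open>{r}\<close> and
  \<open>Q\<close> for the cones. Hypothesis \<open>meet\<close> reflects that a cone containing
  \<open>s\<close> and \<open>t\<close> contains \<open>r\<close> if \<open>t\<close> follows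
  \<open>r\<close> past a level where \<open>s\<close> differs from \<open>r\<close>.\<close>

lemma not_supercompact_tree:
  fixes E :: "(nat \<Rightarrow> bool) set"
  assumes X: "compact_space X" and E: "uncountable E"
    and clopen: "\<And>r. r \<in> E \<Longrightarrow> openin X (C r) \<and> closedin X (C r)"
    and a: "\<And>r. r \<in> E \<Longrightarrow> a r \<in> C r" "\<And>r s. \<lbrakk>r \<in> E; s \<in> E; r \<noteq> s\<rbrakk> \<Longrightarrow> a r \<notin> C s"
    and Q: "countable Q" "\<And>r U. \<lbrakk>r \<in> E; openin X U; a r \<in> U\<rbrakk> \<Longrightarrow> U \<inter> Q \<noteq> {}"
    and meet: "\<And>r s t m. \<lbrakk>r \<in> E; s \<in> E; t \<in> E; s m \<noteq> r m; \<forall>i\<le>m. t i = r i\<rbrakk> \<Longrightarrow> C s \<inter> C t \<subseteq> C r"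
  shows "\<not> supercompact_space X"
proof
  assume "supercompact_space X"
  then obtain B where B: "subbase_of X B" and
    cov': "\<forall>C. C \<subseteq> B \<and> \<Union>C = topspace X \<longrightarrow> (\<exists>D. D \<subseteq> C \<and> finite D \<and> card D \<le> 2 \<and> \<Union>D = topspace X)"
    unfolding supercompact_space_def by auto
  have cov: "\<exists>D. D \<subseteq> C \<and> finite D \<and> card D \<le> 2 \<and> \<Union>D = topspace X" if "C \<subseteq> B" "\<Union>C = topspace X" for C
    using cov'[rule_format, OF conjI, OF that] .
  have Bop: "openin X b" if "b \<in> B" for b
    using B that unfolding subbase_of_iff by simp
  then have Bsub: "\<Union>B \<subseteq> topspace X"
    by (meson Union_least openin_subset)
  have "\<exists>P q. P \<subseteq> B \<and> a r \<notin> \<Union>P \<and> topspace X - \<Union>P \<subseteq> C r \<and> q \<in> Q \<and> q \<in> topspace X - \<Union>P"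
    if r: "r \<in> E" for r
  proof -
    obtain D where D: "finite D" "D \<subseteq> B"
      "\<And>y. y \<in> C r \<Longrightarrow> topspace X - \<Union>{b \<in> D. y \<notin> b} \<subseteq> C r"
      using clopen_blocks[OF X B] clopen[OF r] by blast
    \<comment> \<open>Near \<open>a r\<close>, every subfamily of \<open>D\<close> that covers
      \<open>a r\<close> also covers \<open>q\<close>. Hence the members of \<open>D\<close> missing
      \<open>q\<close> do not cover \<open>a r\<close>, and one basic closed set contains both
      points.\<close>
    define Bad where "Bad = {S. S \<subseteq> D \<and> a r \<in> \<Union>S}"
    have "closedin X (\<Union>S\<in>Bad. topspace X - \<Union>S)"
    proof (intro closedin_Union)
      have "Bad \<subseteq> Pow D" unfolding Bad_def by blast
      then show "finite ((\<lambda>S. topspace X - \<Union>S) ` Bad)"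
        using D(1) finite_subset by blast
      fix T assume "T \<in> (\<lambda>S. topspace X - \<Union>S) ` Bad"
      then obtain S where S: "S \<in> Bad" "T = topspace X - \<Union>S" by blast
      have "openin X (\<Union>S)"
        using S(1) D(2) Bop unfolding Bad_def by (intro openin_Union) blast
      then show "closedin X T" using S(2) by blast
    qed
    then have "openin X (C r - (\<Union>S\<in>Bad. topspace X - \<Union>S))"
      using clopen[OF r] openin_diff by blast
    moreover have "a r \<in> C r - (\<Union>S\<in>Bad. topspace X - \<Union>S)"
      using a(1)[OF r] unfolding Bad_def by blast
    ultimately have "(C r - (\<Union>S\<in>Bad. topspace X - \<Union>S)) \<inter> Q \<noteq> {}"
      by (rule Q(2)[OF r])
    then obtain q where q: "q \<in> Q" "q \<in> C r" "q \<notin> (\<Union>S\<in>Bad. topspace X - \<Union>S)"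
      by blast
    have qX: "q \<in> topspace X"
      using q(2) clopen[OF r] openin_subset by blast
    let ?P = "{b \<in> D. q \<notin> b}"
    have "?P \<notin> Bad" using q(3) qX by blast
    then have "a r \<notin> \<Union>?P" unfolding Bad_def by blast
    moreover have "topspace X - \<Union>?P \<subseteq> C r" using D(3) q by blast
    moreover have "?P \<subseteq> B" "q \<in> topspace X - \<Union>?P" using D qX by auto
    ultimately show ?thesis using q(1) by blast
  qed
  then have "\<forall>r\<in>E. \<exists>P q. P \<subseteq> B \<and> a r \<notin> \<Union>P \<and> topspace X - \<Union>P \<subseteq> C r \<and> q \<in> Q \<and> q \<in> topspace X - \<Union>P"
    by blast
  then obtain P q where "\<forall>r\<in>E. P r \<subseteq> B \<and> a r \<notin> \<Union>(P r) \<and> topspace X - \<Union>(P r) \<subseteq> C r \<and>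
      q r \<in> Q \<and> q r \<in> topspace X - \<Union>(P r)"
    unfolding bchoice_iff by (elim exE) (rule that)
  then have P: "P r \<subseteq> B" "a r \<notin> \<Union>(P r)" "topspace X - \<Union>(P r) \<subseteq> C r" "q r \<in> Q"
      "q r \<in> topspace X - \<Union>(P r)" if "r \<in> E" for r
    using that by blast+
  \<comment> \<open>As \<open>Q\<close> is countable, uncountably many branches share one point
    \<open>x\<close>, and some branch \<open>r\<close> among them is an accumulation point.\<close>
  have "E \<subseteq> (\<Union>x\<in>Q. {r\<in>E. q r = x})"
    using P(4) by blast
  then have "uncountable (\<Union>x\<in>Q. {r\<in>E. q r = x})"
    using E countable_subset by blast
  then obtain x where "uncountable {r\<in>E. q r = x}"
    using Q(1) by (meson countable_UN)
  then obtain r where r: "r \<in> E" "q r = x" and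
    acc: "\<And>n. \<exists>s\<in>{r\<in>E. q r = x}. s \<noteq> r \<and> (\<forall>i<n. s i = r i)"
    by (rule uncountable_branches_accumulate) auto
  \<comment> \<open>The levels at which branches sharing \<open>x\<close> leave \<open>r\<close>;
    accumulation makes them unbounded.\<close>
  define N where "N = {m. \<exists>s\<in>E. q s = x \<and> s m \<noteq> r m \<and> (\<forall>i<m. s i = r i)}"
  have "\<exists>m\<ge>n. m \<in> N" for n
  proof -
    obtain s where s: "s \<in> E" "q s = x" "s \<noteq> r" "\<forall>i<n. s i = r i"
      using acc[of n] by blast
    then obtain m where m: "s m \<noteq> r m" "\<forall>i<m. s i = r i"
      using exists_least_iff[of "\<lambda>m. s m \<noteq> r m"] by auto
    with s have "n \<le> m" using not_le_imp_less by blast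
    with m s show ?thesis unfolding N_def by blast
  qed
  then have Ninf: "infinite N"
    using infinite_nat_iff_unbounded_le by blast
  have "\<forall>m\<in>N. \<exists>s. s \<in> E \<and> q s = x \<and> s m \<noteq> r m \<and> (\<forall>i<m. s i = r i)"
    unfolding N_def by blast
  then obtain f where f: "\<And>m. m \<in> N \<Longrightarrow> f m \<in> E \<and> q (f m) = x \<and> f m m \<noteq> r m \<and> (\<forall>i<m. f m i = r i)"
    by metis
  have "openin X (topspace X - C r)" "closedin X (topspace X - C r)"
    using clopen[OF r(1)] by (auto intro: closedin_diff openin_diff)
  then obtain D where D: "finite D" "D \<subseteq> B"
      "\<And>y. y \<in> topspace X - C r \<Longrightarrow> topspace X - \<Union>{b \<in> D. y \<notin> b} \<subseteq> topspace X - C r"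
    using clopen_blocks[OF X B] by blast
  \<comment> \<open>Finitely many patterns \<open>R m\<close> are possible, so two levels have the
    same one. The basic closed set it determines contains both points \<open>a (f m)\<close> and
    misses \<open>C r\<close>.\<close>
  define R where "R m = {b \<in> D. a (f m) \<notin> b}" for m
  have "finite (R ` N)"
    using D(1) by (intro finite_subset[of "R ` N" "Pow D"]) (auto simp: R_def)
  then obtain m0 where m0: "m0 \<in> N" "infinite {m \<in> N. R m = R m0}"
    using pigeonhole_infinite[OF Ninf] by blast
  then obtain m1 where m1: "m1 \<in> N" "R m1 = R m0" "m0 < m1"
    unfolding infinite_nat_iff_unbounded by blast
  let ?s = "f m0" and ?t = "f m1"
  have E_st: "?s \<in> E" "?t \<in> E" and q_st: "q ?s = x" "q ?t = x"
    using f[OF m0(1)] f[OF m1(1)] by blast+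
  have st: "C ?s \<inter> C ?t \<subseteq> C r"
    using meet[of r ?s ?t m0] f[OF m0(1)] f[OF m1(1)] m1(3) r by auto
  have aX: "a s \<in> topspace X" if "s \<in> E" for s
    using a(1)[OF that] clopen[OF that] openin_subset by blast
  have ne: "?s \<noteq> r" "?t \<noteq> r"
    using f[OF m0(1)] f[OF m1(1)] by auto
  have as: "a ?s \<in> topspace X - C r"
    using E_st(1) r(1) ne(1) aX a(2) by blast
  \<comment> \<open>The pairwise common points are \<open>x\<close>, \<open>a ?s\<close> and
    \<open>a ?t\<close>. A point common to all three sets would lie in
    \<open>C ?s \<inter> C ?t\<close> but outside \<open>C r\<close>.\<close>
  have "\<not> topspace X \<subseteq> \<Union>(P ?s \<union> P ?t \<union> R m0)"
  proof (rule supercompact_linked_triple[OF cov])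
    show "P ?s \<subseteq> B" "P ?t \<subseteq> B" using P(1) E_st by blast+
    show "R m0 \<subseteq> B" using D(2) unfolding R_def by blast
    show "\<not> topspace X \<subseteq> \<Union>(P ?s \<union> P ?t)"
      using P(5)[OF E_st(1)] P(5)[OF E_st(2)] q_st by auto
    show "\<not> topspace X \<subseteq> \<Union>(P ?s \<union> R m0)"
      using P(2)[OF E_st(1)] aX[OF E_st(1)] unfolding R_def by blast
    have "a ?t \<notin> \<Union>(R m0)" using m1(2) unfolding R_def by blast
    then show "\<not> topspace X \<subseteq> \<Union>(P ?t \<union> R m0)"
      using P(2)[OF E_st(2)] aX[OF E_st(2)] by blast
    show "\<Union>B \<subseteq> topspace X" by (rule Bsub)
  qed
  moreover have "topspace X - \<Union>(R m0) \<subseteq> topspace X - C r"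
    using D(3)[OF as] unfolding R_def by blast
  ultimately show False
    using st P(3)[OF E_st(1)] P(3)[OF E_st(2)] by blast
qed

section \<open>Continuous images of Cantor cubes\<close>

lemma uncountable_fibre:
  assumes "uncountable A" "countable B" "f ` A \<subseteq> B"
  obtains b where "b \<in> B" "uncountable {x \<in> A. f x = b}"
proof (rule ccontr)
  assume "\<not> thesis"
  then have "countable (\<Union>b\<in>B. {x \<in> A. f x = b})"
    using that assms(2) by (intro countable_UN) blast+
  moreover have "A \<subseteq> (\<Union>b\<in>B. {x \<in> A. f x = b})" using assms(3) by blast
  ultimately show False using assms(1) countable_subset by blast
qed

text \<open>If some point lies in uncountably many \<open>E i\<close>, it moves into the root and
  induction applies. Otherwise the union of a countable disjoint subfamily meets only countably many
  \<open>E i\<close>, so a maximal disjoint subfamily is uncountable. Here \<open>R\<close> only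
  bounds the pairwise intersections.\<close>

lemma uncountable_delta_system_card:
  assumes "uncountable D" "\<And>i. i \<in> D \<Longrightarrow> finite (E i) \<and> card (E i) = n"
  shows "\<exists>R D'. finite R \<and> D' \<subseteq> D \<and> uncountable D' \<and> (\<forall>i\<in>D'. \<forall>j\<in>D'. i \<noteq> j \<longrightarrow> E i \<inter> E j \<subseteq> R)"
  using assms
proof (induction n arbitrary: D E)
  case 0
  have "E i = {}" if "i \<in> D" for i using "0.prems"(2)[OF that] by auto
  then show ?case using "0.prems"(1) by (intro exI[of _ "{}"] exI[of _ D]) auto
next
  case (Suc n)
  show ?case
  proof (cases "\<exists>a. uncountable {i\<in>D. a \<in> E i}")
    case True
    then obtain a where a: "uncountable {i\<in>D. a \<in> E i}" by blast
    have "\<exists>R D'. finite R \<and> D' \<subseteq> {i\<in>D. a \<in> E i} \<and> uncountable D' \<and>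
        (\<forall>i\<in>D'. \<forall>j\<in>D'. i \<noteq> j \<longrightarrow> (E i - {a}) \<inter> (E j - {a}) \<subseteq> R)"
      using Suc.prems(2) by (intro Suc.IH[OF a]) auto
    then obtain R D' where R: "finite R" "D' \<subseteq> {i\<in>D. a \<in> E i}" "uncountable D'"
        "\<forall>i\<in>D'. \<forall>j\<in>D'. i \<noteq> j \<longrightarrow> (E i - {a}) \<inter> (E j - {a}) \<subseteq> R"
      by blast
    have "D' \<subseteq> D" using R(2) by blast
    moreover have "\<forall>i\<in>D'. \<forall>j\<in>D'. i \<noteq> j \<longrightarrow> E i \<inter> E j \<subseteq> insert a R"
      using R(4) by blast
    ultimately show ?thesis using R(1,3) by (intro exI[of _ "insert a R"] exI[of _ D']) auto
  next
    case False
    define Disj where "Disj = {S. S \<subseteq> D \<and> (\<forall>i\<in>S. \<forall>j\<in>S. i \<noteq> j \<longrightarrow> E i \<inter> E j = {})}"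
    have "\<exists>S\<in>Disj. \<forall>T\<in>Disj. S \<subseteq> T \<longrightarrow> T = S"
    proof (rule subset_Zorn_nonempty)
      have "{} \<in> Disj" unfolding Disj_def by simp
      then show "Disj \<noteq> {}" by blast
      show "\<Union>\<C> \<in> Disj" if "\<C> \<noteq> {}" and ch: "subset.chain Disj \<C>" for \<C>
        unfolding Disj_def
      proof (intro CollectI conjI ballI impI)
        show "\<Union>\<C> \<subseteq> D" using ch unfolding subset.chain_def Disj_def by blast
        fix i j assume ij: "i \<in> \<Union>\<C>" "j \<in> \<Union>\<C>" "i \<noteq> j"
        then obtain S T where ST: "S \<in> \<C>" "T \<in> \<C>" "i \<in> S" "j \<in> T" by blast
        then have "S \<subseteq> T \<or> T \<subseteq> S" using ch unfolding subset_chain_def by blast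
        then obtain V where "V \<in> \<C>" "i \<in> V" "j \<in> V" using ST by blast
        then show "E i \<inter> E j = {}"
          using ch ij(3) unfolding subset.chain_def Disj_def by blast
      qed
    qed
    then obtain S where S: "S \<in> Disj" "\<And>T. \<lbrakk>T \<in> Disj; S \<subseteq> T\<rbrakk> \<Longrightarrow> T = S" by blast
    have "uncountable S"
    proof
      assume cS: "countable S"
      have SD: "S \<subseteq> D" using S(1) unfolding Disj_def by blast
      have "countable (\<Union>i\<in>S. E i)"
        using Suc.prems(2) SD by (intro countable_UN cS) (auto intro: countable_finite)
      moreover have "countable {i\<in>D. a \<in> E i}" for a
        using False by blast
      ultimately have "countable (\<Union>a\<in>(\<Union>i\<in>S. E i). {i\<in>D. a \<in> E i})"
        by (rule countable_UN)
      with cS have "countable (S \<union> (\<Union>a\<in>(\<Union>i\<in>S. E i). {i\<in>D. a \<in> E i}))"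
        by (rule countable_Un)
      then have "\<not> D \<subseteq> S \<union> (\<Union>a\<in>(\<Union>i\<in>S. E i). {i\<in>D. a \<in> E i})"
        using Suc.prems(1) countable_subset by blast
      then obtain i where i: "i \<in> D" "i \<notin> S" "\<forall>j\<in>S. E i \<inter> E j = {}"
        by auto
      have "insert i S \<in> Disj"
        using S(1) i unfolding Disj_def by (auto simp: Int_commute)
      then show False using S(2)[of "insert i S"] i(2) by blast
    qed
    then show ?thesis
      using S(1) unfolding Disj_def by (intro exI[of _ "{}"] exI[of _ S]) auto
  qed
qed

lemma uncountable_delta_system:
  assumes D: "uncountable D" and E: "\<And>i. i \<in> D \<Longrightarrow> finite (E i)"
  shows "\<exists>R D'. finite R \<and> D' \<subseteq> D \<and> uncountable D' \<and> (\<forall>i\<in>D'. \<forall>j\<in>D'. i \<noteq> j \<longrightarrow> E i \<inter> E j \<subseteq> R)"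
proof -
  obtain n where n: "uncountable {i \<in> D. card (E i) = n}"
    using uncountable_fibre[of D "UNIV :: nat set" "\<lambda>i. card (E i)"] D by auto
  have "\<exists>R D'. finite R \<and> D' \<subseteq> {i \<in> D. card (E i) = n} \<and> uncountable D' \<and>
     (\<forall>i\<in>D'. \<forall>j\<in>D'. i \<noteq> j \<longrightarrow> E i \<inter> E j \<subseteq> R)"
    using E by (intro uncountable_delta_system_card[OF n]) auto
  then obtain R D' where R: "finite R" "D' \<subseteq> {i \<in> D. card (E i) = n}" "uncountable D'"
     "\<forall>i\<in>D'. \<forall>j\<in>D'. i \<noteq> j \<longrightarrow> E i \<inter> E j \<subseteq> R"
    by (elim exE conjE)
  then have "D' \<subseteq> D" by blast
  with R(1,3,4) show ?thesis by (intro exI[of _ R] exI[of _ D'] conjI)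
qed

section \<open>Cylinders in Cantor cubes\<close>

lemma openin_cantor_cube_cylinder:
  assumes "openin (cantor_cube I) U" "z \<in> U"
  shows "\<exists>J. finite J \<and> J \<subseteq> I \<and> {w \<in> topspace (cantor_cube I). \<forall>k\<in>J. w k = z k} \<subseteq> U"
proof -
  have "\<exists>V. finite {i \<in> I. V i \<noteq> UNIV} \<and> z \<in> Pi\<^sub>E I V \<and> Pi\<^sub>E I V \<subseteq> U"
    using assms unfolding cantor_cube_def openin_product_topology_alt by auto
  then obtain V where V: "finite {i \<in> I. V i \<noteq> UNIV}" "z \<in> Pi\<^sub>E I V" "Pi\<^sub>E I V \<subseteq> U" by blast
  have "w \<in> U" if w: "w \<in> topspace (cantor_cube I)" "\<forall>k\<in>{i \<in> I. V i \<noteq> UNIV}. w k = z k" for w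
  proof -
    have "w \<in> Pi\<^sub>E I V"
    proof (rule PiE_I)
      show "w k \<in> V k" if "k \<in> I" for k
        using that w(2) V(2) by (cases "V k = UNIV") auto
      show "w k = undefined" if "k \<notin> I" for k
        using that w(1) by (auto simp: cantor_cube_def)
    qed
    then show "w \<in> U" using V(3) by blast
  qed
  then show ?thesis
    using V(1) by (intro exI[of _ "{i \<in> I. V i \<noteq> UNIV}"]) auto
qed

lemma topspace_cantor_cube: "topspace (cantor_cube I) = extensional I"
  by (auto simp: cantor_cube_def PiE_def)

lemma compact_space_cantor_cube: "compact_space (cantor_cube I)"
  by (simp add: cantor_cube_def compact_space_product_topology compact_space_discrete_topology)

lemma clopen_cantor_cube_coordinate:
  assumes "k \<in> I"
  shows "openin (cantor_cube I) {z \<in> topspace (cantor_cube I). z k = b}"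
    and "closedin (cantor_cube I) {z \<in> topspace (cantor_cube I). z k = b}"
proof -
  have *: "continuous_map (cantor_cube I) (discrete_topology (UNIV :: bool set)) (\<lambda>z. z k)"
    using assms unfolding cantor_cube_def by (intro continuous_map_product_projection)
  show "openin (cantor_cube I) {z \<in> topspace (cantor_cube I). z k = b}"
    using openin_continuous_map_preimage[OF *, of "{b}"] by simp
  show "closedin (cantor_cube I) {z \<in> topspace (cantor_cube I). z k = b}"
    using closedin_continuous_map_preimage[OF *, of "{b}"] by simp
qed

lemma closedin_cantor_cube_agree:
  assumes "J \<subseteq> I"
  shows "closedin (cantor_cube I) {w \<in> topspace (cantor_cube I). \<forall>k\<in>J. w k = z k}"
proof -
  have "closedin (cantor_cube I) (\<Inter>(insert (topspace (cantor_cube I))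
      ((\<lambda>k. {w \<in> topspace (cantor_cube I). w k = z k}) ` J)))"
  proof (intro closedin_Inter)
    fix S assume "S \<in> insert (topspace (cantor_cube I)) ((\<lambda>k. {w \<in> topspace (cantor_cube I). w k = z k}) ` J)"
    then show "closedin (cantor_cube I) S"
    proof (elim insertE imageE)
      fix k assume "S = {w \<in> topspace (cantor_cube I). w k = z k}" "k \<in> J"
      then show ?thesis using assms(1) clopen_cantor_cube_coordinate(2)[of k I "z k"] by blast
    qed simp
  qed (use assms in auto)
  moreover have "\<Inter>(insert (topspace (cantor_cube I))
      ((\<lambda>k. {w \<in> topspace (cantor_cube I). w k = z k}) ` J)) = {w \<in> topspace (cantor_cube I). \<forall>k\<in>J. w k = z k}"
    by auto
  ultimately show ?thesis by simp
qed

lemma openin_cantor_cube_agree: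
  assumes "J \<subseteq> I" "finite J"
  shows "openin (cantor_cube I) {w \<in> topspace (cantor_cube I). \<forall>k\<in>J. w k = z k}"
proof -
  have "openin (cantor_cube I) (\<Inter>(insert (topspace (cantor_cube I))
      ((\<lambda>k. {w \<in> topspace (cantor_cube I). w k = z k}) ` J)))"
  proof (intro openin_Inter)
    fix S assume "S \<in> insert (topspace (cantor_cube I)) ((\<lambda>k. {w \<in> topspace (cantor_cube I). w k = z k}) ` J)"
    then show "openin (cantor_cube I) S"
    proof (elim insertE imageE)
      fix k assume "S = {w \<in> topspace (cantor_cube I). w k = z k}" "k \<in> J"
      then show ?thesis using assms(1) clopen_cantor_cube_coordinate(1)[of k I "z k"] by blast
    qed simp
  qed (use assms in auto)
  moreover have "\<Inter>(insert (topspace (cantor_cube I))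
      ((\<lambda>k. {w \<in> topspace (cantor_cube I). w k = z k}) ` J)) = {w \<in> topspace (cantor_cube I). \<forall>k\<in>J. w k = z k}"
    by auto
  ultimately show ?thesis by simp
qed

section \<open>Metrizability from countably many coordinates\<close>

text \<open>The functions inject a compact space continuously into a countable power of the real
  line, which is Hausdorff; so the injection is an embedding.\<close>

lemma metrizable_space_countable_separation:
  assumes X: "compact_space X" and P: "countable P"
    and cont: "\<And>p. p \<in> P \<Longrightarrow> continuous_map X euclideanreal (g p)"
    and sep: "\<And>x y. \<lbrakk>x \<in> topspace X; y \<in> topspace X; x \<noteq> y\<rbrakk> \<Longrightarrow> \<exists>p\<in>P. g p x \<noteq> g p y"
  shows "metrizable_space X"
proof -
  let ?Y = "product_topology (\<lambda>_. euclideanreal) P"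
  define h where "h x = restrict (\<lambda>p. g p x) P" for x
  have "metrizable_space ?Y"
    using P by (simp add: metrizable_space_product_topology metrizable_space_euclidean)
  moreover have "embedding_map X ?Y h"
  proof (rule continuous_imp_embedding_map)
    show "continuous_map X ?Y h"
      using cont unfolding continuous_map_componentwise h_def by (auto intro: continuous_map_eq)
    show "Hausdorff_space ?Y"
      by (simp add: Hausdorff_space_product_topology)
    show "inj_on h (topspace X)"
      using sep unfolding inj_on_def h_def by (metis restrict_apply')
  qed (rule X)
  ultimately show ?thesis
    using embedding_map_imp_homeomorphic_space homeomorphic_metrizable_space metrizable_space_subtopology by blast
qed

text \<open>Cylinders over finite subsets of \<open>D\<close> are countable in number. The images of
  their finite unions form a countable closed network, and Urysohn functions for its disjoint pairs
  separate points.\<close>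

lemma metrizable_space_countable_dependence:
  assumes f: "continuous_map (cantor_cube I) X f" "f ` topspace (cantor_cube I) = topspace X"
    and X: "Hausdorff_space X" and D: "countable D"
    and dep: "\<And>i z b. \<lbrakk>i \<in> I - D; z \<in> topspace (cantor_cube I)\<rbrakk> \<Longrightarrow> f (z(i := b)) = f z"
  shows "metrizable_space X"
proof -
  let ?Z = "cantor_cube I" and ?T = "topspace (cantor_cube I)"
  have cptX: "compact_space X"
    using image_compactin[OF _ f(1), of ?T] compact_space_cantor_cube[of I] f(2)
    unfolding compact_space_def by simp
  \<comment> \<open>Finitely many coordinates outside \<open>D\<close> are changed one at a
    time.\<close>
  have change: "f w = f z" if "finite J" "J \<subseteq> I - D" "z \<in> ?T" "w \<in> ?T" "\<forall>k. k \<notin> J \<longrightarrow> w k = z k" for J z w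
    using that
  proof (induction J arbitrary: w rule: finite_induct)
    case empty
    then have "w = z" by auto
    then show ?case by simp
  next
    case (insert j J)
    have j: "j \<in> I" using insert by blast
    have w': "w(j := z j) \<in> ?T" using insert.prems(3) j unfolding topspace_cantor_cube extensional_def by auto
    have "f (w(j := z j)) = f z"
    proof (rule insert.IH)
      show "J \<subseteq> I - D" using insert.prems(1) by blast
      show "\<forall>k. k \<notin> J \<longrightarrow> (w(j := z j)) k = z k" using insert.prems(4) by simp
    qed (rule insert.prems(2) w')+
    moreover have "f (w(j := z j)) = f w"
      using insert.prems(1,3) by (intro dep) auto
    ultimately show ?case by simp
  qed
  define cyl where "cyl J T = {w \<in> ?T. \<forall>k\<in>J. w k = (k \<in> T)}" for J T
  define \<C> where "\<C> = (\<lambda>(J, T). cyl J T) ` ({J. finite J \<and> J \<subseteq> D \<inter> I} \<times> {T. finite T \<and> T \<subseteq> D \<inter> I})"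
  define \<A> where "\<A> = Union ` {\<D>. finite \<D> \<and> \<D> \<subseteq> \<C>}"
  define \<Q> where "\<Q> = (\<lambda>A. f ` A) ` \<A>"
  have "countable (D \<inter> I)" using D by blast
  then have "countable \<C>"
    unfolding \<C>_def by (intro countable_image countable_SIGMA countable_Collect_finite_subset)
  then have "countable \<Q>"
    unfolding \<Q>_def \<A>_def by (intro countable_image countable_Collect_finite_subset)
  have C_cl: "closedin ?Z C" "openin ?Z C" if C: "C \<in> \<C>" for C
  proof -
    obtain J T where "finite J" "J \<subseteq> I" "C = cyl J T"
      using C unfolding \<C>_def by auto
    then show "closedin ?Z C" "openin ?Z C"
      unfolding cyl_def using closedin_cantor_cube_agree[of J I "\<lambda>k. k \<in> T"]
        openin_cantor_cube_agree[of J I "\<lambda>k. k \<in> T"] by simp_all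
  qed
  have Q_cl: "closedin X Q" if Q: "Q \<in> \<Q>" for Q
  proof -
    obtain \<D> where "finite \<D>" "\<D> \<subseteq> \<C>" "Q = f ` \<Union>\<D>"
      using Q unfolding \<Q>_def \<A>_def by blast
    then have "closedin ?Z (\<Union>\<D>)" using C_cl(1) by (intro closedin_Union) auto
    then have "compactin ?Z (\<Union>\<D>)" using closedin_compact_space compact_space_cantor_cube by blast
    then show ?thesis
      using image_compactin f(1) compactin_imp_closedin[OF X] \<open>Q = f ` \<Union>\<D>\<close> by metis
  qed
  have fine: "\<exists>Q\<in>\<Q>. x \<in> Q \<and> Q \<subseteq> U" if xU: "openin X U" "x \<in> U" for x U
  proof -
    let ?K = "{z \<in> ?T. f z = x}"
    have xX: "x \<in> topspace X" using xU openin_subset by blast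
    then have "closedin X {x}" using X by (intro closedin_Hausdorff_finite) auto
    then have "closedin ?Z {z \<in> ?T. f z \<in> {x}}"
      by (rule closedin_continuous_map_preimage[OF f(1)])
    then have K: "compactin ?Z ?K"
      using closedin_compact_space compact_space_cantor_cube by fastforce
    have opU: "openin ?Z {z \<in> ?T. f z \<in> U}"
      by (rule openin_continuous_map_preimage[OF f(1) xU(1)])
    have "\<exists>C\<in>\<C>. z \<in> C \<and> f ` C \<subseteq> U" if z: "z \<in> ?K" for z
    proof -
      have zU: "z \<in> {z \<in> ?T. f z \<in> U}" using z xU(2) by auto
      obtain J where "finite J \<and> J \<subseteq> I \<and> {w \<in> ?T. \<forall>k\<in>J. w k = z k} \<subseteq> {z \<in> ?T. f z \<in> U}"
        using openin_cantor_cube_cylinder[OF opU zU] ..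
      then have J: "finite J" "J \<subseteq> I" "{w \<in> ?T. \<forall>k\<in>J. w k = z k} \<subseteq> {z \<in> ?T. f z \<in> U}"
        by simp_all
      let ?C = "cyl (J \<inter> D) {k \<in> J \<inter> D. z k}"
      have "?C \<in> \<C>" unfolding \<C>_def using J(1,2) by auto
      moreover have "z \<in> ?C" using z unfolding cyl_def by auto
      moreover have "f w \<in> U" if w: "w \<in> ?C" for w
      proof -
        define w' where "w' k = (if k \<in> J - D then z k else w k)" for k
        have w'T: "w' \<in> ?T"
          using w J(2) unfolding w'_def cyl_def topspace_cantor_cube extensional_def by auto
        have "f w' = f w"
          by (rule change[of "J - D"]) (use J w w'T in \<open>auto simp: w'_def cyl_def\<close>)
        moreover have "w' \<in> {z \<in> ?T. f z \<in> U}"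
          by (rule subsetD[OF J(3)]) (use w w'T in \<open>auto simp: w'_def cyl_def\<close>)
        ultimately show ?thesis by simp
      qed
      ultimately show ?thesis by blast
    qed
    then obtain C where C: "\<And>z. z \<in> ?K \<Longrightarrow> C z \<in> \<C> \<and> z \<in> C z \<and> f ` C z \<subseteq> U" by metis
    have "\<exists>\<D>. finite \<D> \<and> \<D> \<subseteq> C ` ?K \<and> ?K \<subseteq> \<Union>\<D>"
      by (rule compactinD[OF K]) (use C C_cl(2) in blast)+
    then obtain \<D> where \<D>: "finite \<D>" "\<D> \<subseteq> C ` ?K" "?K \<subseteq> \<Union>\<D>" by blast
    have "\<D> \<subseteq> \<C>" using \<D>(2) C by blast
    then have "f ` \<Union>\<D> \<in> \<Q>" unfolding \<Q>_def \<A>_def using \<D>(1) by blast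
    moreover have "x \<in> f ` \<Union>\<D>"
    proof -
      obtain z where "z \<in> ?T" "f z = x" using xX unfolding f(2)[symmetric] by blast
      then show ?thesis using \<D>(3) by blast
    qed
    moreover have "f ` \<Union>\<D> \<subseteq> U" using \<D>(2) C by blast
    ultimately show ?thesis by (intro bexI[of _ "f ` \<Union>\<D>"] conjI)
  qed
  define P where "P = {(Q, Q'). Q \<in> \<Q> \<and> Q' \<in> \<Q> \<and> disjnt Q Q'}"
  have "countable P"
    by (rule countable_subset[of _ "\<Q> \<times> \<Q>"]) (use \<open>countable \<Q>\<close> in \<open>auto simp: P_def\<close>)
  have "normal_space X"
    using cptX X compact_Hausdorff_or_regular_imp_normal_space by blast
  then have "\<forall>p\<in>P. \<exists>g. continuous_map X euclideanreal g \<and> g ` fst p \<subseteq> {0} \<and> g ` snd p \<subseteq> {1}"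
    unfolding normal_space_iff_Urysohn_alt P_def using Q_cl by fastforce
  then obtain g where g: "\<And>p. p \<in> P \<Longrightarrow> continuous_map X euclideanreal (g p) \<and> g p ` fst p \<subseteq> {0} \<and> g p ` snd p \<subseteq> {1}"
    by metis
  show ?thesis
  proof (rule metrizable_space_countable_separation[OF cptX \<open>countable P\<close>])
    show "continuous_map X euclideanreal (g p)" if "p \<in> P" for p
      using g[OF that] by blast
    fix x y assume xy: "x \<in> topspace X" "y \<in> topspace X" "x \<noteq> y"
    then obtain U V where UV: "openin X U" "openin X V" "x \<in> U" "y \<in> V" "disjnt U V"
      using X unfolding Hausdorff_space_def by metis
    obtain Q where Q: "Q \<in> \<Q>" "x \<in> Q" "Q \<subseteq> U" using fine[OF UV(1,3)] by blast
    obtain Q' where Q': "Q' \<in> \<Q>" "y \<in> Q'" "Q' \<subseteq> V" using fine[OF UV(2,4)] by blast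
    have p: "(Q, Q') \<in> P"
      using Q Q' UV(5) unfolding P_def by (auto simp: disjnt_def)
    have "g (Q, Q') x = 0" "g (Q, Q') y = 1" using g[OF p] Q(2) Q'(2) by auto
    then show "\<exists>p\<in>P. g p x \<noteq> g p y" using p by (intro bexI[of _ "(Q, Q')"]) auto
  qed
qed

section \<open>Free subcubes of uncountable dimension\<close>

text \<open>Disjoint neighbourhoods of the two values pull back to open sets containing cylinders;
  the coordinates of both cylinders, together with \<open>i\<close>, form a finite support.\<close>

lemma cantor_cube_separating_coordinates:
  assumes f: "continuous_map (cantor_cube I) X f" and X: "Hausdorff_space X"
    and z: "z \<in> topspace (cantor_cube I)" and i: "i \<in> I" and ne: "f (z(i := True)) \<noteq> f (z(i := False))"
  shows "\<exists>J. finite J \<and> J \<subseteq> I \<and> i \<in> J \<and> (\<forall>w\<in>topspace (cantor_cube I). \<forall>w'\<in>topspace (cantor_cube I).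
     (\<forall>k\<in>J - {i}. w k = z k \<and> w' k = z k) \<and> w i \<and> \<not> w' i \<longrightarrow> f w \<noteq> f w')"
proof -
  let ?T = "topspace (cantor_cube I)"
  have zT: "z(i := b) \<in> ?T" for b
    using z i by (auto simp: topspace_cantor_cube extensional_def)
  then have fX: "f (z(i := b)) \<in> topspace X" for b
    using continuous_map_image_subset_topspace[OF f] by blast
  have "\<exists>U V. openin X U \<and> openin X V \<and> f (z(i := True)) \<in> U \<and> f (z(i := False)) \<in> V \<and> disjnt U V"
    using X[unfolded Hausdorff_space_def, rule_format, OF conjI, OF fX conjI, OF fX ne] .
  then obtain U V where UV: "openin X U" "openin X V" "f (z(i := True)) \<in> U" "f (z(i := False)) \<in> V" "disjnt U V"
    by (elim exE conjE)
  have "openin (cantor_cube I) {w \<in> ?T. f w \<in> U}" "z(i := True) \<in> {w \<in> ?T. f w \<in> U}"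
    using openin_continuous_map_preimage[OF f UV(1)] zT UV(3) by simp_all
  from openin_cantor_cube_cylinder[OF this]
  obtain J where J: "finite J \<and> J \<subseteq> I \<and> {w \<in> ?T. \<forall>k\<in>J. w k = (z(i := True)) k} \<subseteq> {w \<in> ?T. f w \<in> U}" ..
  have "openin (cantor_cube I) {w \<in> ?T. f w \<in> V}" "z(i := False) \<in> {w \<in> ?T. f w \<in> V}"
    using openin_continuous_map_preimage[OF f UV(2)] zT UV(4) by simp_all
  from openin_cantor_cube_cylinder[OF this]
  obtain J' where J': "finite J' \<and> J' \<subseteq> I \<and> {w \<in> ?T. \<forall>k\<in>J'. w k = (z(i := False)) k} \<subseteq> {w \<in> ?T. f w \<in> V}" ..
  show ?thesis
  proof (intro exI[of _ "insert i (J \<union> J')"] conjI ballI impI)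
    show "finite (insert i (J \<union> J'))" "insert i (J \<union> J') \<subseteq> I" "i \<in> insert i (J \<union> J')"
      using J J' i by auto
    fix w w' assume w: "w \<in> ?T" "w' \<in> ?T"
      "(\<forall>k\<in>insert i (J \<union> J') - {i}. w k = z k \<and> w' k = z k) \<and> w i \<and> \<not> w' i"
    have "w \<in> {w \<in> ?T. \<forall>k\<in>J. w k = (z(i := True)) k}" using w by auto
    then have "f w \<in> U" using J by blast
    have "w' \<in> {w \<in> ?T. \<forall>k\<in>J'. w k = (z(i := False)) k}" using w by auto
    then have "f w' \<in> V" using J' by blast
    with \<open>f w \<in> U\<close> UV(5) show "f w \<noteq> f w'" unfolding disjnt_def by auto
  qed
qed

text \<open>The supports are thinned to a \<Delta>-system on whose root the witnesses agree. They
  then glue to one point \<open>base\<close>, and the support of each \<open>i\<close> meets the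
  free coordinates only in \<open>i\<close>.\<close>

lemma uncountable_free_subcube:
  assumes f: "continuous_map (cantor_cube I) X f" and X: "Hausdorff_space X"
    and D: "uncountable D" "D \<subseteq> I"
    and dep: "\<And>i. i \<in> D \<Longrightarrow> \<exists>z\<in>topspace (cantor_cube I). f (z(i := True)) \<noteq> f (z(i := False))"
  shows "\<exists>D' base. uncountable D' \<and> D' \<subseteq> I \<and> base \<in> topspace (cantor_cube I) \<and>
    (\<forall>i\<in>D'. \<forall>u v. i \<in> u \<and> i \<notin> v \<longrightarrow>
       f (\<lambda>k. if k \<in> D' then k \<in> u else base k) \<noteq> f (\<lambda>k. if k \<in> D' then k \<in> v else base k))"
proof -
  let ?T = "topspace (cantor_cube I)"
  define separates where "separates i z J \<longleftrightarrow> (\<forall>w\<in>?T. \<forall>w'\<in>?T.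
     (\<forall>k\<in>J - {i}. w k = z k \<and> w' k = z k) \<and> w i \<and> \<not> w' i \<longrightarrow> f w \<noteq> f w')" for i z J
  have "\<forall>i\<in>D. \<exists>z J. z \<in> ?T \<and> finite J \<and> J \<subseteq> I \<and> i \<in> J \<and> separates i z J"
  proof
    fix i assume i: "i \<in> D"
    obtain z where z: "z \<in> ?T" "f (z(i := True)) \<noteq> f (z(i := False))" using dep[OF i] by blast
    have "i \<in> I" using i D by blast
    have "\<exists>J. finite J \<and> J \<subseteq> I \<and> i \<in> J \<and> separates i z J"
      unfolding separates_def by (rule cantor_cube_separating_coordinates[OF f X z(1) \<open>i \<in> I\<close> z(2)])
    with z(1) show "\<exists>z J. z \<in> ?T \<and> finite J \<and> J \<subseteq> I \<and> i \<in> J \<and> separates i z J" by blast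
  qed
  then obtain z J where zJ: "\<forall>i\<in>D. z i \<in> ?T \<and> finite (J i) \<and> J i \<subseteq> I \<and> i \<in> J i \<and> separates i (z i) (J i)"
    by metis
  have Jfin: "finite (J i)" if "i \<in> D" for i using zJ that by blast
  then have "\<exists>R D1. finite R \<and> D1 \<subseteq> D \<and> uncountable D1 \<and> (\<forall>i\<in>D1. \<forall>j\<in>D1. i \<noteq> j \<longrightarrow> J i \<inter> J j \<subseteq> R)"
    by (rule uncountable_delta_system[OF D(1)])
  then obtain R D1 where R: "finite R" and D1: "D1 \<subseteq> D" "uncountable D1"
    and root: "\<forall>i\<in>D1. \<forall>j\<in>D1. i \<noteq> j \<longrightarrow> J i \<inter> J j \<subseteq> R"
    by (elim exE conjE)
  \<comment> \<open>Discarding the finite root and fixing one of the finitely many patterns on it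
    leaves uncountably many indices.\<close>
  have "uncountable (D1 - R)"
    using D1(2) R by (simp add: uncountable_minus_countable countable_finite)
  then obtain S where S: "uncountable {i \<in> D1 - R. {k \<in> R. z i k} = S}"
    by (rule uncountable_fibre[of _ "Pow R" "\<lambda>i. {k \<in> R. z i k}"]) (use R in \<open>auto intro: countable_finite\<close>)
  define D' where "D' = {i \<in> D1 - R. {k \<in> R. z i k} = S}"
  have D'sub: "D' \<subseteq> D" "D' \<subseteq> I" using D1(1) D(2) unfolding D'_def by auto
  have agree: "z i k = z j k" if "i \<in> D'" "j \<in> D'" "k \<in> J i" "k \<in> J j" for i j k
  proof (cases "i = j")
    case False
    then have "k \<in> R" using root that unfolding D'_def by blast
    then show ?thesis using that(1,2) unfolding D'_def by blast
  qed simp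
  \<comment> \<open>The witnesses glued along their supports, false at the other coordinates in
    \<open>I\<close>; \<open>undefined\<close> off \<open>I\<close> keeps the point
    extensional.\<close>
  define base where "base k = (if k \<in> I then \<exists>i\<in>D'. k \<in> J i \<and> z i k else undefined)" for k
  have base: "base k = z i k" if "i \<in> D'" "k \<in> J i" for i k
    using agree[OF that(1) _ that(2)] that zJ D'sub(1) unfolding base_def by (metis subsetD)
  have baseT: "base \<in> ?T" by (auto simp: base_def topspace_cantor_cube extensional_def)
  define pt where "pt u k = (if k \<in> D' then k \<in> u else base k)" for u k
  have ptT: "pt u \<in> ?T" for u
    using baseT D'sub(2) by (auto simp: pt_def topspace_cantor_cube extensional_def)
  have "f (pt u) \<noteq> f (pt v)" if i: "i \<in> D'" and uv: "i \<in> u" "i \<notin> v" for i u v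
  proof -
    have "pt u' k = z i k" if k: "k \<in> J i - {i}" for u' k
    proof -
      \<comment> \<open>Otherwise \<open>k\<close> would belong to the two supports
        \<open>J i\<close> and \<open>J k\<close>, hence to the root, which \<open>D'\<close>
        avoids.\<close>
      have "k \<notin> D'"
      proof
        assume "k \<in> D'"
        then have "k \<in> J k" using zJ D'sub(1) by blast
        then have "k \<in> R" using root k i \<open>k \<in> D'\<close> unfolding D'_def by blast
        then show False using \<open>k \<in> D'\<close> unfolding D'_def by blast
      qed
      then show ?thesis using base[OF i] k unfolding pt_def by auto
    qed
    moreover have "pt u i" "\<not> pt v i" using i uv unfolding pt_def by auto
    moreover have "separates i (z i) (J i)"
      using zJ D'sub(1) i by blast
    ultimately show ?thesis using ptT unfolding separates_def by blast
  qed
  then show ?thesis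
    using S D'sub(2) baseT unfolding D'_def[symmetric] pt_def[abs_def]
    by (intro exI[of _ D'] exI[of _ base]) auto
qed

section \<open>Cones of branches inside a dyadic space\<close>

text \<open>Cardinals are comparable: either \<open>D\<close> injects into the set of all branches,
  or all branches inject into \<open>D\<close>.\<close>

lemma uncountable_reindex_branches:
  assumes "uncountable D"
  shows "\<exists>(E :: (nat \<Rightarrow> bool) set) c. uncountable E \<and> inj_on c E \<and> c ` E \<subseteq> D"
proof -
  have "(card_of D, card_of (UNIV :: (nat \<Rightarrow> bool) set)) \<in> ordLeq \<or>
      (card_of (UNIV :: (nat \<Rightarrow> bool) set), card_of D) \<in> ordLeq"
    by (intro ordLeq_total card_of_Well_order)
  then show ?thesis
    unfolding card_of_ordLeq[symmetric]
  proof (elim disjE exE conjE)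
    fix b :: "'a \<Rightarrow> nat \<Rightarrow> bool" assume b: "inj_on b D"
    have "uncountable (b ` D)"
      using assms b countable_image_inj_on by blast
    moreover have "inj_on (inv_into D b) (b ` D)" "inv_into D b ` (b ` D) \<subseteq> D"
      using b by (auto simp: inj_on_inv_into)
    ultimately show ?thesis by blast
  next
    fix c :: "(nat \<Rightarrow> bool) \<Rightarrow> 'a" assume c: "inj_on c UNIV" "c ` UNIV \<subseteq> D"
    have "uncountable (UNIV :: (nat \<Rightarrow> bool) set)"
    proof
      assume cnt: "countable (UNIV :: (nat \<Rightarrow> bool) set)"
      define g where "g = from_nat_into (UNIV :: (nat \<Rightarrow> bool) set)"
      have "range g = UNIV" unfolding g_def using range_from_nat_into cnt by blast
      \<comment> \<open>Cantor's diagonal sequence differs from every \<open>g n\<close> at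
        \<open>n\<close>.\<close>
      then obtain n where "g n = (\<lambda>k. \<not> g k k)" by (metis rangeE UNIV_I)
      then show False by metis
    qed
    then show ?thesis using c by blast
  qed
qed

text \<open>Sets \<open>S\<close> of branches are coded by points \<open>\<phi> S\<close> of
  \<open>X\<close>. The closure \<open>K\<close> of the countably many coded cones satisfies the
  hypotheses of \<open>not_supercompact_tree\<close>, with \<open>C r\<close> the part of
  \<open>K\<close> coming from sets that contain \<open>r\<close>.\<close>

lemma not_hereditarily_supercompact:
  assumes f: "continuous_map (cantor_cube I) X f" and X: "Hausdorff_space X" "compact_space X"
    and D: "uncountable D" "D \<subseteq> I"
    and dep: "\<And>i. i \<in> D \<Longrightarrow> \<exists>z\<in>topspace (cantor_cube I). f (z(i := True)) \<noteq> f (z(i := False))"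
  shows "\<not> hereditarily_supercompact_space X"
proof -
  let ?Z = "cantor_cube I" and ?T = "topspace (cantor_cube I)"
  have "\<exists>D' base. uncountable D' \<and> D' \<subseteq> I \<and> base \<in> ?T \<and>
    (\<forall>i\<in>D'. \<forall>u v. i \<in> u \<and> i \<notin> v \<longrightarrow>
       f (\<lambda>k. if k \<in> D' then k \<in> u else base k) \<noteq> f (\<lambda>k. if k \<in> D' then k \<in> v else base k))"
    by (rule uncountable_free_subcube[OF f X(1) D dep])
  then obtain D' base where D': "uncountable D'" "D' \<subseteq> I" and base: "base \<in> ?T" and
    sep: "\<forall>i\<in>D'. \<forall>u v. i \<in> u \<and> i \<notin> v \<longrightarrow>
       f (\<lambda>k. if k \<in> D' then k \<in> u else base k) \<noteq> f (\<lambda>k. if k \<in> D' then k \<in> v else base k)"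
    by (elim exE conjE)
  obtain E :: "(nat \<Rightarrow> bool) set" and c where E: "uncountable E" and c: "inj_on c E" "c ` E \<subseteq> D'"
    using uncountable_reindex_branches[OF D'(1)] by blast
  define pt where "pt S = (\<lambda>k. if k \<in> D' then k \<in> c ` S else base k)" for S
  have ptT: "pt S \<in> ?T" for S
    using base D'(2) by (auto simp: pt_def topspace_cantor_cube extensional_def)
  define \<phi> where "\<phi> S = f (pt S)" for S
  define N where "N t = {r \<in> E. \<forall>i<length t. r i = t ! i}" for t :: "bool list"
  define Q where "Q = (\<lambda>t. \<phi> (N t)) ` UNIV"
  define side where "side b r = \<phi> ` {S. S \<subseteq> E \<and> (r \<in> S) = b}" for b r
  have \<phi>X: "\<phi> S \<in> topspace X" for S
    unfolding \<phi>_def using ptT f continuous_map_image_subset_topspace by blast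
  have c_iff: "c r \<in> c ` S \<longleftrightarrow> r \<in> S" if "r \<in> E" "S \<subseteq> E" for r S
    using c(1) that by (simp add: inj_on_image_mem_iff)
  have side_disj: "side True r \<inter> side False r = {}" if r: "r \<in> E" for r
  proof -
    have "\<phi> S \<noteq> \<phi> S'" if S: "S \<subseteq> E" "r \<in> S" "S' \<subseteq> E" "r \<notin> S'" for S S'
    proof -
      have "c r \<in> c ` S" "c r \<notin> c ` S'" using c_iff[OF r S(1)] c_iff[OF r S(3)] S by simp_all
      moreover have "c r \<in> D'" using r c(2) by blast
      ultimately show ?thesis
        using sep[rule_format, of "c r" "c ` S" "c ` S'"] unfolding \<phi>_def pt_def by simp
    qed
    then show ?thesis unfolding side_def by auto
  qed
  have side_cl: "closedin X (side b r)" if r: "r \<in> E" for b r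
  proof -
    have "pt ` {S. S \<subseteq> E \<and> (r \<in> S) = b} =
      {w \<in> ?T. \<forall>k\<in>I - c ` E. w k = pt {} k} \<inter> {w \<in> ?T. w (c r) = b}" (is "?L = ?R")
    proof
      have off: "pt S k = pt {} k" if "S \<subseteq> E" "k \<notin> c ` E" for S k
        using that unfolding pt_def by auto
      have at: "pt S (c r) = (r \<in> S)" if "S \<subseteq> E" for S
        using c_iff[OF r that] r c(2) unfolding pt_def by auto
      have "pt S \<in> ?R" if S: "S \<subseteq> E" "(r \<in> S) = b" for S
        using off[OF S(1)] at[OF S(1)] S(2) ptT by (intro IntI CollectI conjI ballI) blast+
      then show "?L \<subseteq> ?R" by blast
      show "?R \<subseteq> ?L"
      proof
        fix w assume w: "w \<in> ?R"
        let ?S = "{s \<in> E. w (c s)}"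
        have "pt ?S k = w k" for k
        proof (cases "k \<in> c ` E")
          case True
          then obtain s where "s \<in> E" "k = c s" by blast
          then show ?thesis using c_iff[of s ?S] c(2) unfolding pt_def by auto
        next
          case False
          then have *: "pt ?S k = pt {} k" unfolding pt_def by auto
          show ?thesis
          proof (cases "k \<in> I")
            case True
            then show ?thesis using * w False by auto
          next
            case False
            then show ?thesis using w ptT[of ?S] by (auto simp: topspace_cantor_cube extensional_def)
          qed
        qed
        then have "pt ?S = w" by blast
        moreover have "(r \<in> ?S) = b" using r w by auto
        ultimately show "w \<in> ?L" by (intro image_eqI[of _ _ ?S]) auto
      qed
    qed
    moreover have "closedin ?Z {w \<in> ?T. \<forall>k\<in>I - c ` E. w k = pt {} k}"
      by (rule closedin_cantor_cube_agree) blast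
    moreover have "closedin ?Z {w \<in> ?T. w (c r) = b}"
      using r c(2) D'(2) by (intro clopen_cantor_cube_coordinate) auto
    ultimately have "closedin ?Z (pt ` {S. S \<subseteq> E \<and> (r \<in> S) = b})"
      by (simp add: closedin_Int)
    then have "compactin ?Z (pt ` {S. S \<subseteq> E \<and> (r \<in> S) = b})"
      using closedin_compact_space compact_space_cantor_cube by blast
    then have "compactin X (f ` pt ` {S. S \<subseteq> E \<and> (r \<in> S) = b})"
      using image_compactin f by blast
    then show ?thesis
      unfolding side_def \<phi>_def using compactin_imp_closedin[OF X(1)] by (simp add: image_image)
  qed
  define K where "K = X closure_of Q"
  have QX: "Q \<subseteq> topspace X" using \<phi>X unfolding Q_def by blast
  have QK: "Q \<subseteq> K" unfolding K_def using QX by (rule closure_of_subset)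
  have NE: "N t \<subseteq> E" for t unfolding N_def by blast
  have K_side: "K \<subseteq> side True r \<union> side False r" if "r \<in> E" for r
    unfolding K_def
  proof (rule closure_of_minimal)
    show "closedin X (side True r \<union> side False r)" using side_cl[OF that] by blast
    show "Q \<subseteq> side True r \<union> side False r"
      using NE unfolding Q_def side_def by blast
  qed
  let ?Y = "subtopology X K"
  have Kcl: "closedin X K" unfolding K_def by simp
  define C where "C r = K \<inter> side True r" for r
  \<comment> \<open>The two sides of \<open>r\<close> are disjoint, closed and cover
    \<open>K\<close>, so \<open>C r\<close> is clopen in \<open>K\<close>.\<close>
  have CK: "K - C r = K \<inter> side False r" if "r \<in> E" for r
    using K_side[OF that] side_disj[OF that] unfolding C_def by blast
  have topY: "topspace ?Y = K" using closedin_subset[OF Kcl] by auto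
  have dense: "U \<inter> Q \<noteq> {}" if U: "openin X U" "\<phi> {r} \<in> U" and r: "r \<in> E" for U r
  proof -
    have "openin ?Z {w \<in> ?T. f w \<in> U}" "pt {r} \<in> {w \<in> ?T. f w \<in> U}"
      using openin_continuous_map_preimage[OF f U(1)] ptT U(2) unfolding \<phi>_def by simp_all
    from openin_cantor_cube_cylinder[OF this]
    obtain J where J: "finite J \<and> J \<subseteq> I \<and> {w \<in> ?T. \<forall>k\<in>J. w k = pt {r} k} \<subseteq> {w \<in> ?T. f w \<in> U}" ..
    have "finite (c ` {s \<in> E. c s \<in> J})"
      using J by (auto intro: finite_subset[of _ J])
    moreover have "inj_on c {s \<in> E. c s \<in> J}"
      using c(1) by (rule inj_on_subset) blast
    ultimately have "finite {s \<in> E. c s \<in> J}"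
      by (rule finite_imageD)
    then have fin: "finite ({s \<in> E. c s \<in> J} - {r})" by simp
    \<comment> \<open>A level where \<open>s\<close> leaves \<open>r\<close>. Cutting
      \<open>r\<close> at a length \<open>n\<close> beyond these levels gives a cone that agrees
      with \<open>{r}\<close> at all coordinates in \<open>J\<close>.\<close>
    define l where "l s = (SOME i. s i \<noteq> r i)" for s
    have l: "s (l s) \<noteq> r (l s)" if "s \<noteq> r" for s
      using that someI_ex[of "\<lambda>i. s i \<noteq> r i"] unfolding l_def by blast
    obtain n where n: "\<And>s. s \<in> {s \<in> E. c s \<in> J} - {r} \<Longrightarrow> l s < n"
      using finite_nat_set_iff_bounded[of "l ` ({s \<in> E. c s \<in> J} - {r})"] fin by auto
    let ?t = "map r [0..<n]"
    have N_J: "s \<in> N ?t \<longleftrightarrow> s = r" if "s \<in> E" "c s \<in> J" for s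
      using that l[of s] n[of s] r unfolding N_def by auto
    have "pt (N ?t) k = pt {r} k" if "k \<in> J" for k
    proof (cases "k \<in> c ` E")
      case True
      then obtain s where s: "s \<in> E" "k = c s" by blast
      then have "c s \<in> c ` N ?t \<longleftrightarrow> c s \<in> c ` {r}"
        using N_J[of s] that c_iff[of s "N ?t"] c_iff[of s "{r}"] NE r by auto
      then show ?thesis using s unfolding pt_def by auto
    next
      case False
      then show ?thesis using NE[of ?t] r unfolding pt_def by auto
    qed
    then have "pt (N ?t) \<in> {w \<in> ?T. f w \<in> U}" using J ptT by blast
    then show ?thesis unfolding Q_def \<phi>_def by blast
  qed
  have \<phi>K: "\<phi> {r} \<in> K" if "r \<in> E" for r
    unfolding K_def in_closure_of using \<phi>X dense[OF _ _ that] by blast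
  have Copen: "openin ?Y (C r)" and Cclosed: "closedin ?Y (C r)" if r: "r \<in> E" for r
  proof -
    have *: "closedin ?Y (K \<inter> side b r)" for b
      using side_cl[OF r] by (metis closedin_subtopology inf_commute)
    then show "closedin ?Y (C r)" unfolding C_def .
    have "openin ?Y (topspace ?Y - (K - C r))"
      unfolding CK[OF r] using * by blast
    moreover have "topspace ?Y - (K - C r) = C r" unfolding topY C_def by blast
    ultimately show "openin ?Y (C r)" by simp
  qed
  have "\<not> supercompact_space ?Y"
  proof (rule not_supercompact_tree[where E = E and C = C and a = "\<lambda>r. \<phi> {r}" and Q = Q])
    show "compact_space ?Y"
      using Kcl X(2) closedin_compact_space compact_space_subtopology by blast
    show "uncountable E" by (rule E)
    show "openin ?Y (C r) \<and> closedin ?Y (C r)" if "r \<in> E" for r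
      using Copen Cclosed that by blast
    show "\<phi> {r} \<in> C r" if "r \<in> E" for r
      using \<phi>K[OF that] that unfolding C_def side_def by blast
    show "\<phi> {r} \<notin> C s" if rs: "r \<in> E" "s \<in> E" "r \<noteq> s" for r s
    proof -
      have "\<phi> {r} \<in> side False s" using rs unfolding side_def by blast
      then show ?thesis using side_disj[OF rs(2)] unfolding C_def by blast
    qed
    show "countable Q" unfolding Q_def by simp
    show "U \<inter> Q \<noteq> {}" if U: "r \<in> E" "openin ?Y U" "\<phi> {r} \<in> U" for r U
    proof -
      obtain V where V: "openin X V" "U = V \<inter> K"
        using U(2) unfolding openin_subtopology by blast
      then have "V \<inter> Q \<noteq> {}" using dense U(1,3) by blast
      then show ?thesis using V(2) QK by blast
    qed
    show "C s \<inter> C t \<subseteq> C r" if E3: "r \<in> E" "s \<in> E" "t \<in> E" and m: "s m \<noteq> r m" "\<forall>i\<le>m. t i = r i" for r s t m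
    proof
      fix x assume x: "x \<in> C s \<inter> C t"
      show "x \<in> C r"
      proof (rule ccontr)
        assume "x \<notin> C r"
        \<comment> \<open>A counterexample would give a nonempty open subset of \<open>K\<close>,
          which must contain some coded cone \<open>\<phi> (N w)\<close>.\<close>
        have "openin ?Y (C s \<inter> C t - C r)"
          using Copen Cclosed E3 by blast
        then obtain V where V: "openin X V" "C s \<inter> C t - C r = V \<inter> K"
          unfolding openin_subtopology by blast
        have "x \<in> V" "x \<in> K" using V(2) x \<open>x \<notin> C r\<close> by blast+
        then obtain w where w: "\<phi> (N w) \<in> V"
          using V(1) unfolding K_def in_closure_of Q_def by blast
        moreover have "\<phi> (N w) \<in> K" using QK unfolding Q_def by blast
        ultimately have wC: "\<phi> (N w) \<in> C s" "\<phi> (N w) \<in> C t" "\<phi> (N w) \<notin> C r" using V(2) by blast+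
        have iff: "\<phi> (N w) \<in> C v \<longleftrightarrow> v \<in> N w" if v: "v \<in> E" for v
        proof (cases "v \<in> N w")
          case True
          then show ?thesis using \<open>\<phi> (N w) \<in> K\<close> NE unfolding C_def side_def by blast
        next
          case False
          then have "\<phi> (N w) \<in> side False v" using NE unfolding side_def by blast
          then show ?thesis using side_disj[OF v] False unfolding C_def by blast
        qed
        \<comment> \<open>A node \<open>w\<close> longer than \<open>m\<close> would force
          \<open>s m = t m = r m\<close>; a shorter one is an initial segment of \<open>r\<close>,
          because \<open>t\<close> agrees with \<open>r\<close> that far.\<close>
        have "s \<in> N w" "t \<in> N w" "r \<notin> N w" using wC iff E3 by blast+
        then show False
          using m E3(1) unfolding N_def by (cases "m < length w") auto
      qed
    qed
  qed
  then show ?thesis using Kcl unfolding hereditarily_supercompact_space_def by blast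
qed

section \<open>Counting the essential coordinates of the parametrization\<close>

theorem theorem2p9:
  fixes X :: "'a topology"
  assumes "dyadic_space TYPE('i) X"
    and "Hausdorff_space X"
  shows "metrizable_space X \<longleftrightarrow> hereditarily_supercompact_space X"
proof
  have cpt: "compact_space X"
    using assms(1) unfolding dyadic_space_def by blast
  show "hereditarily_supercompact_space X" if "metrizable_space X"
    using compact_metrizable_imp_hereditarily_supercompact cpt that by blast
  show "metrizable_space X" if her: "hereditarily_supercompact_space X"
  proof -
    obtain I :: "'i set" and f where f: "continuous_map (cantor_cube I) X f"
      "f ` topspace (cantor_cube I) = topspace X"
      using assms(1) unfolding dyadic_space_def by blast
    \<comment> \<open>The coordinates on which \<open>f\<close> depends: uncountably many would
      contradict hereditary supercompactness, and countably many give metrizability.\<close>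
    define D where "D = {i \<in> I. \<exists>z\<in>topspace (cantor_cube I). f (z(i := True)) \<noteq> f (z(i := False))}"
    have "countable D"
    proof (rule ccontr)
      assume "uncountable D"
      then have "\<not> hereditarily_supercompact_space X"
        by (rule not_hereditarily_supercompact[OF f(1) assms(2) cpt]) (auto simp: D_def)
      with her show False by simp
    qed
    then show ?thesis
    proof (rule metrizable_space_countable_dependence[OF f assms(2)])
      fix i z b assume "i \<in> I - D" "z \<in> topspace (cantor_cube I)"
      then have "f (z(i := True)) = f (z(i := False))" unfolding D_def by blast
      moreover have "z(i := z i) = z" by simp
      \<comment> \<open>One of the two updates of \<open>z\<close> is \<open>z\<close> itself, so
        equality of their images settles both values of \<open>b\<close>.\<close>
      ultimately show "f (z(i := b)) = f z"
        by (cases b; cases "z i") (metis (full_types))+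
    qed
  qed
qed

end
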